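(* Let $p\in[1,+\infty[$. The canonical selector $[g]\mapsto g\circ\ell_g^{\#}$ is continuous from the space of finite Fréchet curves in $\mathbb R^n$, provided with the strengthened Fréchet metric $d^+$, into the Sobolev space $W_{1,p}^n[0,+\infty[$, in the following sense: if $[\gamma]$ and $[\gamma_i]$, $i\in\mathbb N$, are finite Fréchet curves in $\mathbb R^n$ with $\lim_{i\to\infty}d^+([\gamma_i],[\gamma])=0$, and $T<+\infty$ is such that $\ell_\gamma(\infty)\le T$ and $\ell_{\gamma_i}(\infty)\le T$ for all $i$, then $$\lim_{i\to\infty}\left\|\gamma_i\circ\ell_{\gamma_i}^{\#}-\gamma\circ\ell_\gamma^{\#}\right\|_{W_{1,p}^n[0,T]}=0 .$$
   Context: "Absolutely continuous" on a non-compact interval means absolutely continuous on each compact subinterval. Let $\mathcal T$ be the set of increasing absolutely continuous bijections $\alpha:[0,+\infty[\to[0,+\infty[$ with absolutely continuous inverse. Two absolutely continuous functions $g_1,g_2:[0,+\infty[\to\mathbb R^n$ are equivalent if $\inf_{\alpha\in\mathcal T}\|g_1-g_2\circ\alpha\|_{L_\infty[0,+\infty[}=0$. The equivalence class $[g]$ is called a Fréchet curve in $\mathbb R^n$; elements of $[g]$ are its representatives (parameterizations). The arc-length function of $g$ is $\ell_g(t)=\int_0^t|\dot g(s)|\,ds$; the total length $\ell_g(\infty)=\lim_{t\to\infty}\ell_g(t)$ depends only on $[g]$. $[g]$ is finite if $\ell_g(\infty)<+\infty$; then $g(\infty)=\lim_{t\to\infty}g(t)$ exists. For nondecreasing $\alpha:[0,+\infty[\to[0,+\infty[$,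 put $\alpha^{\#}(t)=\sup\{s\ge0:\alpha(s)\le t\}$. The canonical representative of a finite Fréchet curve $[g]$ is $g\circ\ell_g^{\#}$, extended by $g\circ\ell_g^{\#}(t)=g(\infty)$ for all $t\ge\ell_g(\infty)$; it depends only on $[g]$. The mapping $[g]\mapsto g\circ\ell_g^{\#}$ is called the canonical selector. The Fréchet metric is $d([g_1],[g_2])=\inf_{\alpha\in\mathcal T}\|g_1-g_2\circ\alpha\|_{L_\infty[0,+\infty[}$ and the strengthened Fréchet metric on finite Fréchet curves is $d^+([g_1],[g_2])=d([g_1],[g_2])+|\ell_{g_1}(\infty)-\ell_{g_2}(\infty)|$. *)

theory Defs
  imports "HOL-Analysis.Analysis" "HOL-Probability.Essential_Supremum"
begin

section \<open>Absolutely continuous functions\<close>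

definition absolutely_continuous_on :: "real set \<Rightarrow> (real \<Rightarrow> 'a::real_normed_vector) \<Rightarrow> bool"
  where "absolutely_continuous_on S f \<longleftrightarrow>
    (\<forall>\<epsilon>>0. \<exists>\<delta>>0. \<forall>(n::nat) a b.
       (\<forall>k<n. a k \<le> b k \<and> {a k..b k} \<subseteq> S) \<and>
       disjoint_family_on (\<lambda>k. {a k<..<b k}) {..<n} \<and>
       (\<Sum>k<n. b k - a k) < \<delta>
       \<longrightarrow> (\<Sum>k<n. norm (f (b k) - f (a k))) < \<epsilon>)"

text \<open>On the non-compact interval \<open>[0,\<infinity>[\<close>, absolute continuity is understood locally. Functions
  on \<open>[0,\<infinity>[\<close> are represented by functions on all reals, whose values on negative arguments are
  irrelevant throughout.\<close>

definition ac_paths :: "(real \<Rightarrow> 'a::real_normed_vector) set"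
  where "ac_paths = {g. \<forall>u v. 0 \<le> u \<longrightarrow> u \<le> v \<longrightarrow> absolutely_continuous_on {u..v} g}"

definition reparametrizations :: "(real \<Rightarrow> real) set"
  where "reparametrizations =
    {\<alpha>. bij_betw \<alpha> {0..} {0..} \<and> strict_mono_on {0..} \<alpha> \<and>
        \<alpha> \<in> ac_paths \<and> the_inv_into {0..} \<alpha> \<in> ac_paths}"


section \<open>Frechet curves\<close>

definition Linf_norm :: "(real \<Rightarrow> real ^ 'n) \<Rightarrow> ereal"
  where "Linf_norm f = esssup (lebesgue_on {0..}) (\<lambda>t. ereal (norm (f t)))"

definition path_dist :: "(real \<Rightarrow> real ^ 'n) \<Rightarrow> (real \<Rightarrow> real ^ 'n) \<Rightarrow> ereal"
  where "path_dist g1 g2 = (INF \<alpha>\<in>reparametrizations. Linf_norm (\<lambda>t. g1 t - g2 (\<alpha> t)))"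

definition frechet_rel :: "((real \<Rightarrow> real ^ 'n) \<times> (real \<Rightarrow> real ^ 'n)) set"
  where "frechet_rel = {(g1, g2). g1 \<in> ac_paths \<and> g2 \<in> ac_paths \<and> path_dist g1 g2 = 0}"

definition frechet_curves :: "(real \<Rightarrow> real ^ 'n) set set"
  where "frechet_curves = ac_paths // frechet_rel"

definition arc_length :: "(real \<Rightarrow> real ^ 'n) \<Rightarrow> real \<Rightarrow> real"
  where "arc_length g t =
    set_lebesgue_integral lebesgue {0..t} (\<lambda>s. norm (vector_derivative g (at s)))"

definition total_length :: "(real \<Rightarrow> real ^ 'n) \<Rightarrow> ereal"
  where "total_length g = Lim at_top (\<lambda>t. ereal (arc_length g t))"

text \<open>Notions on curves are obtained by evaluating the corresponding notions at a representative;
  the result does not depend on which one is chosen.\<close>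

definition representative :: "(real \<Rightarrow> real ^ 'n) set \<Rightarrow> real \<Rightarrow> real ^ 'n"
  where "representative \<Gamma> = (SOME g. g \<in> \<Gamma>)"

definition curve_length :: "(real \<Rightarrow> real ^ 'n) set \<Rightarrow> ereal"
  where "curve_length \<Gamma> = total_length (representative \<Gamma>)"

definition finite_frechet_curves :: "(real \<Rightarrow> real ^ 'n) set set"
  where "finite_frechet_curves = {\<Gamma> \<in> frechet_curves. curve_length \<Gamma> < \<infinity>}"

definition frechet_dist :: "(real \<Rightarrow> real ^ 'n) set \<Rightarrow> (real \<Rightarrow> real ^ 'n) set \<Rightarrow> ereal"
  where "frechet_dist \<Gamma>1 \<Gamma>2 = path_dist (representative \<Gamma>1) (representative \<Gamma>2)"

definition strong_frechet_dist :: "(real \<Rightarrow> real ^ 'n) set \<Rightarrow> (real \<Rightarrow> real ^ 'n) set \<Rightarrow> ereal"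
  where "strong_frechet_dist \<Gamma>1 \<Gamma>2 =
    frechet_dist \<Gamma>1 \<Gamma>2 + \<bar>curve_length \<Gamma>1 - curve_length \<Gamma>2\<bar>"


section \<open>The canonical representative\<close>

text \<open>The supremum is meaningful only when the set is nonempty and bounded above. In
  \<open>canonical_rep\<close> below, \<open>sharp (arc_length g) t\<close> matters only for
  \<open>0 \<le> t < total_length g\<close>, where this is the case.\<close>

definition sharp :: "(real \<Rightarrow> real) \<Rightarrow> real \<Rightarrow> real"
  where "sharp \<alpha> t = Sup {s. 0 \<le> s \<and> \<alpha> s \<le> t}"

definition canonical_rep :: "(real \<Rightarrow> real ^ 'n) \<Rightarrow> real \<Rightarrow> real ^ 'n"
  where "canonical_rep g t =
    (if ereal t < total_length g then g (sharp (arc_length g) t) else Lim at_top g)"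


section \<open>Sobolev spaces on a compact interval\<close>

text \<open>In one dimension the elements of \<open>W\<^bsub>1,p\<^esub>[0,T]\<close> are the absolutely continuous functions whose
  almost everywhere defined derivative is in \<open>L\<^sub>p\<close>; the values assigned to \<open>vector_derivative\<close> on
  the exceptional null set are irrelevant.\<close>

definition sobolev_space :: "real \<Rightarrow> real \<Rightarrow> (real \<Rightarrow> real ^ 'n) set"
  where "sobolev_space p T =
    {f. absolutely_continuous_on {0..T} f \<and>
        set_integrable lebesgue {0..T} (\<lambda>t. norm (f t) powr p) \<and>
        set_integrable lebesgue {0..T} (\<lambda>t. norm (vector_derivative f (at t)) powr p)}"

definition sobolev_norm :: "real \<Rightarrow> real \<Rightarrow> (real \<Rightarrow> real ^ 'n) \<Rightarrow> real"
  where "sobolev_norm p T f =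
    (set_lebesgue_integral lebesgue {0..T} (\<lambda>t. norm (f t) powr p) +
     set_lebesgue_integral lebesgue {0..T} (\<lambda>t. norm (vector_derivative f (at t)) powr p))
      powr (1 / p)"

end

theory Submission
  imports Defs
begin

text \<open>Let \<open>h\<close> and \<open>h\<^sub>i\<close> be the canonical representatives. They are 1-Lipschitz and constant beyond the
  lengths \<open>L\<close> and \<open>L\<^sub>i\<close>. Since length is lower semicontinuous, both on an initial piece of the
  curve and on the complementary final piece, \<open>L\<^sub>i \<longlonglongrightarrow> L\<close> forces the arc lengths at corresponding
  points to be uniformly close, so that \<open>h\<^sub>i \<longlonglongrightarrow> h\<close> uniformly. Then also \<open>h\<^sub>i + h \<longlonglongrightarrow> 2h\<close>, and
  semicontinuity once more shows that the length of \<open>h\<^sub>i + h\<close> on \<open>[0,L]\<close> is asymptotically at least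
  \<open>2L\<close>. As the derivatives have norm at most 1, the parallelogram law turns this into convergence
  of the derivatives in \<open>L\<^sub>2\<close>, hence, by boundedness, in every \<open>L\<^sub>p\<close>.

  Arc length is an integral of a derivative, whereas semicontinuity concerns sums of chords. The two
  agree because an absolutely continuous function \<open>f\<close> is the difference of nondecreasing absolutely
  continuous ones, whose Stieltjes measures have densities by the Radon-Nikodym theorem, and because
  \<open>\<bar>f'\<bar> \<le> V'\<close> almost everywhere for its variation function \<open>V\<close>.\<close>

section \<open>Chord sums and variation\<close>

text \<open>Passing from uniform convergence of the representatives to convergence of their
  derivatives is a quantitative Radon-Riesz argument. Uniform convergence alone permits fast
  oscillations of the derivatives; these cost length, and convergence of the lengths excludes them.
  Unit speed enters only as the Lipschitz bound 1 together with the lower bound L for the length of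
  the representative. Semicontinuity yields lower bounds only. An upper bound for the length of an
  initial piece is therefore the total length minus a lower bound for the final piece, and this is
  why both pieces occur. Curves are compared through finite chord sums: for a fixed partition,
  nearness at its points changes the sum by an amount that depends only on their number, whatever
  the reparametrization. The partition is chosen for the limit curve alone, so every \<delta>
  obtained from it is uniform over all competing curves.\<close>

fun chord_sum :: "(real \<Rightarrow> 'a::real_normed_vector) \<Rightarrow> real list \<Rightarrow> real" where
  "chord_sum f (x # y # zs) = norm (f y - f x) + chord_sum f (y # zs)"
| "chord_sum f [x] = 0"
| "chord_sum f [] = 0"

definition partitions :: "real \<Rightarrow> real \<Rightarrow> real list set"
  where "partitions a b = {xs. sorted xs \<and> set xs \<subseteq> {a..b}}"

definition bounded_variation :: "(real \<Rightarrow> 'a::real_normed_vector) \<Rightarrow> real \<Rightarrow> real \<Rightarrow> bool"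
  where "bounded_variation f a b \<longleftrightarrow> bdd_above (chord_sum f ` partitions a b)"

definition variation :: "(real \<Rightarrow> 'a::real_normed_vector) \<Rightarrow> real \<Rightarrow> real \<Rightarrow> real"
  where "variation f a b = (SUP xs\<in>partitions a b. chord_sum f xs)"

lemma chord_sum_nonneg: "0 \<le> chord_sum f xs"
  by (induction f xs rule: chord_sum.induct) auto

lemma chord_sum_Cons_ge: "chord_sum f xs \<le> chord_sum f (x # xs)"
  by (cases xs) auto

lemma chord_sum_append_ge: "chord_sum f xs + chord_sum f ys \<le> chord_sum f (xs @ ys)"
proof (induction f xs rule: chord_sum.induct)
  case (2 f x)
  then show ?case using chord_sum_Cons_ge[of f ys x] by simp
qed (auto simp: chord_sum_nonneg)

text \<open>By the triangle inequality a detour through \<open>c\<close> can only lengthen the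
  polygon, wherever \<open>c\<close> lies.\<close>

lemma chord_sum_split_le: "chord_sum f (xs @ ys) \<le> chord_sum f (xs @ [c]) + chord_sum f (c # ys)"
proof (induction f xs rule: chord_sum.induct)
  case (2 f x)
  have "norm (f y - f x) \<le> norm (f c - f x) + norm (f y - f c)" for y
    using norm_triangle_ineq[of "f c - f x" "f y - f c"] by simp
  then show ?case by (cases ys) (auto simp: chord_sum_nonneg intro: add_increasing)
next
  case (3 f)
  then show ?case using chord_sum_Cons_ge[of f ys c] by simp
qed auto

text \<open>Semicontinuity of length in finite form: a chord has two endpoints, each moved by at
  most \<delta>, so the error depends only on the number of points. The map \<open>\<beta>\<close>
  provides for a change of parameter.\<close>

lemma chord_sum_close:
  assumes "\<And>x. x \<in> set xs \<Longrightarrow> norm (f (\<beta> x) - g x) \<le> \<delta>" "0 \<le> \<delta>"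
  shows "chord_sum g xs \<le> chord_sum f (map \<beta> xs) + 2 * \<delta> * length xs"
  using assms(1)
proof (induction g xs rule: chord_sum.induct)
  case (1 g x y zs)
  have "norm (g y - g x) \<le> norm (f (\<beta> y) - f (\<beta> x)) + \<delta> + \<delta>"
  proof -
    have eq: "g y - g x = (f (\<beta> y) - f (\<beta> x)) - (f (\<beta> y) - g y) + (f (\<beta> x) - g x)" by simp
    have "norm (g y - g x) \<le> norm (f (\<beta> y) - f (\<beta> x)) + norm (f (\<beta> y) - g y) + norm (f (\<beta> x) - g x)"
      unfolding eq by (meson add_right_mono norm_triangle_ineq norm_triangle_ineq4 order_trans)
    moreover have "norm (f (\<beta> y) - g y) \<le> \<delta>" "norm (f (\<beta> x) - g x) \<le> \<delta>" using 1(2) by auto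
    ultimately show ?thesis by linarith
  qed
  moreover have "chord_sum g (y # zs) \<le> chord_sum f (map \<beta> (y # zs)) + 2 * \<delta> * length (y # zs)"
    using 1 by auto
  ultimately show ?case by (simp add: algebra_simps)
qed (use assms(2) in auto)

lemma chord_sum_cong:
  assumes "\<And>x. x \<in> set xs \<Longrightarrow> f (\<beta> x) = g x"
  shows "chord_sum f (map \<beta> xs) = chord_sum g xs"
  using assms by (induction g xs rule: chord_sum.induct) auto

lemma partitions_Nil [simp]: "[] \<in> partitions a b"
  by (simp add: partitions_def)

lemma partitions_mono: "a' \<le> a \<Longrightarrow> b \<le> b' \<Longrightarrow> partitions a b \<subseteq> partitions a' b'"
  by (force simp: partitions_def)

lemma partitions_map:
  assumes "xs \<in> partitions a b" "\<And>x y. a \<le> x \<Longrightarrow> x \<le> y \<Longrightarrow> y \<le> b \<Longrightarrow> \<beta> x \<le> \<beta> y"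
  shows "map \<beta> xs \<in> partitions (\<beta> a) (\<beta> b)"
proof -
  have "sorted (map \<beta> xs)" if "sorted xs" "set xs \<subseteq> {a..b}" using that
    by (induction xs) (auto intro!: assms(2))
  then show ?thesis using assms by (fastforce simp: partitions_def)
qed

lemma partitions_append: "xs \<in> partitions a c \<Longrightarrow> ys \<in> partitions c b \<Longrightarrow> a \<le> c \<Longrightarrow> c \<le> b \<Longrightarrow> xs @ ys \<in> partitions a b"
  by (fastforce simp: partitions_def sorted_append)

text \<open>Cut the list at \<open>c\<close> and add \<open>c\<close> to both pieces. The bounds on
  the number of points keep the error of \<open>chord_sum_close\<close> under control when the
  pieces are compared with another curve.\<close>

lemma chain_split:
  assumes "xs \<in> partitions a b" "a \<le> c" "c \<le> b"
  obtains ys zs where "ys \<in> partitions a c" "zs \<in> partitions c b"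
    "chord_sum f xs \<le> chord_sum f ys + chord_sum f zs"
    "length ys \<le> length xs + 1" "length zs \<le> length xs + 1"
proof
  let ?l = "takeWhile (\<lambda>x. x \<le> c) xs" and ?r = "dropWhile (\<lambda>x. x \<le> c) xs"
  have s: "sorted xs" "set xs \<subseteq> {a..b}" using assms by (auto simp: partitions_def)
  have r: "c < x" if "x \<in> set ?r" for x
  proof -
    have "?r \<noteq> []" using that by force
    moreover from this have "\<not> (hd ?r \<le> c)" by (rule hd_dropWhile)
    moreover have "sorted ?r" using s by (simp add: sorted_dropWhile)
    ultimately show ?thesis using that by (cases ?r) auto
  qed
  show "?l @ [c] \<in> partitions a c"
  proof -
    have "x \<le> c" "x \<in> set xs" if "x \<in> set ?l" for x using set_takeWhileD[OF that] by auto
    moreover have "set ?l \<subseteq> {a..b}" using set_takeWhileD s(2) by fast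
    ultimately show ?thesis using s assms by (auto simp: partitions_def sorted_append sorted_takeWhile)
  qed
  show "c # ?r \<in> partitions c b"
    using s assms r by (auto simp: partitions_def sorted_dropWhile less_imp_le dest: set_dropWhileD)
  show "chord_sum f xs \<le> chord_sum f (?l @ [c]) + chord_sum f (c # ?r)"
    using chord_sum_split_le[of f ?l ?r c] by simp
  show "length (?l @ [c]) \<le> length xs + 1" "length (c # ?r) \<le> length xs + 1"
    by (auto simp: length_takeWhile_le length_dropWhile_le)
qed

lemma chord_sum_le_variation:
  "bounded_variation f a b \<Longrightarrow> xs \<in> partitions a b \<Longrightarrow> chord_sum f xs \<le> variation f a b"
  unfolding bounded_variation_def variation_def by (rule cSUP_upper)

lemma variation_least: "(\<And>xs. xs \<in> partitions a b \<Longrightarrow> chord_sum f xs \<le> B) \<Longrightarrow> variation f a b \<le> B"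
  unfolding variation_def by (rule cSUP_least) (auto intro: partitions_Nil)

lemma bounded_variationI: "(\<And>xs. xs \<in> partitions a b \<Longrightarrow> chord_sum f xs \<le> B) \<Longrightarrow> bounded_variation f a b"
  unfolding bounded_variation_def by (rule bdd_aboveI2)

lemma bounded_variation_subset:
  "bounded_variation f a b \<Longrightarrow> a \<le> a' \<Longrightarrow> b' \<le> b \<Longrightarrow> bounded_variation f a' b'"
  by (meson bounded_variationI partitions_mono chord_sum_le_variation subsetD)

lemma variation_nonneg: "bounded_variation f a b \<Longrightarrow> 0 \<le> variation f a b"
  using chord_sum_le_variation[of f a b "[]"] by simp

lemma norm_diff_le_variation:
  "bounded_variation f a b \<Longrightarrow> a \<le> b \<Longrightarrow> norm (f b - f a) \<le> variation f a b"
  using chord_sum_le_variation[of f a b "[a, b]"] by (simp add: partitions_def)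

lemma variation_approx:
  assumes "bounded_variation f a b" "0 < e"
  obtains xs where "xs \<in> partitions a b" "variation f a b - e < chord_sum f xs"
proof -
  have "\<exists>xs\<in>partitions a b. variation f a b - e < chord_sum f xs"
    unfolding variation_def
    by (subst less_cSUP_iff[symmetric])
       (use assms in \<open>auto simp: bounded_variation_def variation_def[symmetric] intro: partitions_Nil\<close>)
  then show ?thesis using that by blast
qed

text \<open>One inequality cuts a partition at \<open>c\<close>, the other concatenates two
  partitions. The latter takes the suprema one at a time, with the other term subtracted, and so
  avoids approximating partitions.\<close>

lemma variation_combine:
  assumes "bounded_variation f a c" "bounded_variation f c b" "a \<le> c" "c \<le> b"
  shows "bounded_variation f a b" "variation f a c + variation f c b = variation f a b"
proof -
  have le: "chord_sum f xs \<le> variation f a c + variation f c b" if xs: "xs \<in> partitions a b" for xs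
  proof -
    obtain ys zs where "ys \<in> partitions a c" "zs \<in> partitions c b" "chord_sum f xs \<le> chord_sum f ys + chord_sum f zs"
      using chain_split[OF xs assms(3,4)] by metis
    then show ?thesis using chord_sum_le_variation[OF assms(1)] chord_sum_le_variation[OF assms(2)] by fastforce
  qed
  then show bv: "bounded_variation f a b" by (rule bounded_variationI)
  have "variation f a c \<le> variation f a b - variation f c b"
  proof (rule variation_least)
    fix xs assume xs: "xs \<in> partitions a c"
    have "variation f c b \<le> variation f a b - chord_sum f xs"
    proof (rule variation_least)
      fix ys assume "ys \<in> partitions c b"
      then show "chord_sum f ys \<le> variation f a b - chord_sum f xs"
        using chord_sum_le_variation[OF bv partitions_append[OF xs _ assms(3,4)]] chord_sum_append_ge[of f xs ys]
        by fastforce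
    qed
    then show "chord_sum f xs \<le> variation f a b - variation f c b" by simp
  qed
  with variation_least[OF le] show "variation f a c + variation f c b = variation f a b" by force
qed

lemma variation_self: "variation f a a = 0"
proof -
  have "chord_sum f xs = 0" if "xs \<in> partitions a a" for xs
    using that by (induction f xs rule: chord_sum.induct) (auto simp: partitions_def)
  then have "chord_sum f ` partitions a a = {0}" by (auto intro!: image_eqI[of _ _ "[]"])
  then show ?thesis by (simp add: variation_def)
qed

section \<open>Absolutely continuous functions and their variation\<close>

text \<open>The matrix of the definition of absolute continuity, isolated so that one \<delta> can
  be fixed and applied to several families of intervals.\<close>

definition ac_modulus :: "real set \<Rightarrow> (real \<Rightarrow> 'a::real_normed_vector) \<Rightarrow> real \<Rightarrow> real \<Rightarrow> bool"
  where "ac_modulus S f \<epsilon> \<delta> \<longleftrightarrow> (\<forall>(n::nat) a b.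
       (\<forall>k<n. a k \<le> b k \<and> {a k..b k} \<subseteq> S) \<and>
       disjoint_family_on (\<lambda>k. {a k<..<b k}) {..<n} \<and>
       (\<Sum>k<n. b k - a k) < \<delta>
       \<longrightarrow> (\<Sum>k<n. norm (f (b k) - f (a k))) < \<epsilon>)"

lemma absolutely_continuous_on_iff_modulus:
  "absolutely_continuous_on S f \<longleftrightarrow> (\<forall>\<epsilon>>0. \<exists>\<delta>>0. ac_modulus S f \<epsilon> \<delta>)"
  unfolding absolutely_continuous_on_def ac_modulus_def ..

lemma ac_modulusI:
  assumes "\<And>(n::nat) a b. \<lbrakk>\<And>k. k < n \<Longrightarrow> a k \<le> b k \<and> {a k..b k} \<subseteq> S;
      disjoint_family_on (\<lambda>k. {a k<..<b k}) {..<n}; (\<Sum>k<n. b k - a k) < \<delta>\<rbrakk>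
      \<Longrightarrow> (\<Sum>k<n. norm (f (b k) - f (a k))) < \<epsilon>"
  shows "ac_modulus S f \<epsilon> \<delta>"
  unfolding ac_modulus_def by (intro allI impI assms) auto

lemma ac_modulusD:
  fixes n :: nat
  assumes "ac_modulus S f \<epsilon> \<delta>" "\<And>k. k < n \<Longrightarrow> a k \<le> b k \<and> {a k..b k} \<subseteq> S"
    "disjoint_family_on (\<lambda>k. {a k<..<b k}) {..<n}" "(\<Sum>k<n. b k - a k) < \<delta>"
  shows "(\<Sum>k<n. norm (f (b k) - f (a k))) < \<epsilon>"
  using assms(2-) by (intro assms(1)[unfolded ac_modulus_def, rule_format]) auto

lemma ac_modulus_interval:
  assumes "ac_modulus S f \<epsilon> \<delta>" "u \<le> v" "{u..v} \<subseteq> S" "v - u < \<delta>"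
  shows "norm (f v - f u) < \<epsilon>"
  using ac_modulusD[OF assms(1), of 1 "\<lambda>_. u" "\<lambda>_. v"] assms(2-)
  by (simp add: disjoint_family_on_def)

lemma ac_modulus_subset:
  assumes "ac_modulus S f \<epsilon> \<delta>" "S' \<subseteq> S"
  shows "ac_modulus S' f \<epsilon> \<delta>"
  by (rule ac_modulusI, rule ac_modulusD[OF assms(1)]) (use assms(2) in auto)

lemma absolutely_continuous_on_subset:
  "absolutely_continuous_on S f \<Longrightarrow> S' \<subseteq> S \<Longrightarrow> absolutely_continuous_on S' f"
  unfolding absolutely_continuous_on_iff_modulus using ac_modulus_subset by metis

lemma absolutely_continuous_on_imp_continuous_on:
  assumes "absolutely_continuous_on {a..b} f"
  shows "continuous_on {a..b} f"
  unfolding continuous_on_iff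
proof (intro ballI allI impI)
  fix x e :: real assume x: "x \<in> {a..b}" "0 < e"
  then obtain \<delta> where \<delta>: "0 < \<delta>" "ac_modulus {a..b} f e \<delta>"
    using assms unfolding absolutely_continuous_on_iff_modulus by blast
  have "dist (f y) (f x) < e" if y: "y \<in> {a..b}" "dist y x < \<delta>" for y
  proof (cases "x \<le> y")
    case True
    then show ?thesis using ac_modulus_interval[OF \<delta>(2), of x y] x y by (auto simp: dist_norm)
  next
    case False
    then show ?thesis using ac_modulus_interval[OF \<delta>(2), of y x] x y
      by (auto simp: dist_norm norm_minus_commute)
  qed
  with \<delta>(1) show "\<exists>d>0. \<forall>y\<in>{a..b}. dist y x < d \<longrightarrow> dist (f y) (f x) < e" by blast
qed

lemma lipschitz_imp_absolutely_continuous_on: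
  assumes "\<And>x y. x \<in> S \<Longrightarrow> y \<in> S \<Longrightarrow> x \<le> y \<Longrightarrow> norm (f y - f x) \<le> C * (y - x)"
  shows "absolutely_continuous_on S f"
  unfolding absolutely_continuous_on_iff_modulus
proof (intro allI impI)
  fix \<epsilon> :: real assume \<epsilon>: "0 < \<epsilon>"
  \<comment> \<open>\<open>\<bar>C\<bar> + 1\<close> is a positive divisor for every real
    \<open>C\<close>.\<close>
  have "ac_modulus S f \<epsilon> (\<epsilon> / (\<bar>C\<bar> + 1))"
  proof (rule ac_modulusI)
    fix n :: nat and a b
    assume ab: "\<And>k. k < n \<Longrightarrow> a k \<le> b k \<and> {a k..b k} \<subseteq> S" "(\<Sum>k<n. b k - a k) < \<epsilon> / (\<bar>C\<bar> + 1)"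
    have "(\<Sum>k<n. norm (f (b k) - f (a k))) \<le> (\<Sum>k<n. (\<bar>C\<bar> + 1) * (b k - a k))"
    proof (rule sum_mono)
      fix k assume "k \<in> {..<n}"
      then have k: "a k \<in> S" "b k \<in> S" "a k \<le> b k" using ab(1)[of k] by auto
      have "norm (f (b k) - f (a k)) \<le> C * (b k - a k)" using assms k by blast
      also have "\<dots> \<le> (\<bar>C\<bar> + 1) * (b k - a k)" using k by (intro mult_right_mono) auto
      finally show "norm (f (b k) - f (a k)) \<le> (\<bar>C\<bar> + 1) * (b k - a k)" .
    qed
    also have "\<dots> = (\<bar>C\<bar> + 1) * (\<Sum>k<n. b k - a k)" by (simp add: sum_distrib_left)
    also have "\<dots> < \<epsilon>" using ab(2) by (simp add: field_simps)
    finally show "(\<Sum>k<n. norm (f (b k) - f (a k))) < \<epsilon>" .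
  qed
  then show "\<exists>\<delta>>0. ac_modulus S f \<epsilon> \<delta>"
    using \<epsilon> by (intro exI[of _ "\<epsilon> / (\<bar>C\<bar> + 1)"]) simp
qed

text \<open>Stieltjes measures are built from functions on the whole line. Extension by the boundary
  values keeps the same \<delta>, since the clamp is monotone and nonexpansive.\<close>

lemma absolutely_continuous_on_clamp:
  fixes a b :: real
  assumes "absolutely_continuous_on {a..b} f" "a \<le> b"
  shows "absolutely_continuous_on UNIV (\<lambda>t. f (max a (min b t)))"
  unfolding absolutely_continuous_on_iff_modulus
proof (intro allI impI)
  fix \<epsilon> :: real assume \<epsilon>: "0 < \<epsilon>"
  define c where "c t = max a (min b t)" for t
  obtain \<delta> where \<delta>: "0 < \<delta>" "ac_modulus {a..b} f \<epsilon> \<delta>"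
    using assms \<epsilon> unfolding absolutely_continuous_on_iff_modulus by blast
  have "ac_modulus UNIV (\<lambda>t. f (c t)) \<epsilon> \<delta>"
  proof (rule ac_modulusI, rule ac_modulusD[OF \<delta>(2)])
    fix n :: nat and u v
    assume uv: "\<And>k. k < n \<Longrightarrow> u k \<le> v k \<and> {u k..v k} \<subseteq> UNIV"
      and disj: "disjoint_family_on (\<lambda>k. {u k<..<v k}) {..<n}" and len: "(\<Sum>k<n. v k - u k) < \<delta>"
    show "c (u k) \<le> c (v k) \<and> {c (u k)..c (v k)} \<subseteq> {a..b}" if "k < n" for k
      using uv[OF that] assms(2) by (auto simp: c_def)
    \<comment> \<open>Where the clamp moves an endpoint, the interval shrinks or becomes empty, so
      disjointness survives.\<close>
    have "{c (u k)<..<c (v k)} \<subseteq> {u k<..<v k}" for k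
      by (auto simp: c_def max_def min_def split: if_splits)
    with disj show "disjoint_family_on (\<lambda>k. {c (u k)<..<c (v k)}) {..<n}"
      unfolding disjoint_family_on_def by blast
    have "(\<Sum>k<n. c (v k) - c (u k)) \<le> (\<Sum>k<n. v k - u k)"
    proof (rule sum_mono)
      fix k assume "k \<in> {..<n}"
      then have "u k \<le> v k" using uv by auto
      then show "c (v k) - c (u k) \<le> v k - u k" by (auto simp: c_def max_def min_def)
    qed
    with len show "(\<Sum>k<n. c (v k) - c (u k)) < \<delta>" by simp
  qed
  with \<delta>(1) show "\<exists>\<delta>>0. ac_modulus UNIV (\<lambda>t. f (max a (min b t))) \<epsilon> \<delta>"
    unfolding c_def by blast
qed

section \<open>Refinement of families of intervals by partitions\<close>

abbreviation (input) nonoverlapping :: "real \<times> real \<Rightarrow> real \<times> real \<Rightarrow> bool"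
  where "nonoverlapping p q \<equiv> {fst p<..<snd p} \<inter> {fst q<..<snd q} = {}"

text \<open>Lists are easier to concatenate than indexed families: pairwise nonoverlap becomes
  \<open>sorted_wrt\<close>, which splits over append. Repeated degenerate intervals are harmless,
  their open interiors being empty.\<close>

lemma ac_modulus_list:
  assumes "ac_modulus S f \<epsilon> \<delta>"
    and ps: "\<And>p. p \<in> set ps \<Longrightarrow> fst p \<le> snd p \<and> {fst p..snd p} \<subseteq> S"
      "sorted_wrt (\<lambda>p q. nonoverlapping p q) ps" "(\<Sum>p\<leftarrow>ps. snd p - fst p) < \<delta>"
  shows "(\<Sum>p\<leftarrow>ps. norm (f (snd p) - f (fst p))) < \<epsilon>"
proof -
  have "(\<Sum>k<length ps. norm (f (snd (ps ! k)) - f (fst (ps ! k)))) < \<epsilon>"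
  proof (rule ac_modulusD[OF assms(1)])
    show "fst (ps ! k) \<le> snd (ps ! k) \<and> {fst (ps ! k)..snd (ps ! k)} \<subseteq> S" if "k < length ps" for k
      using ps(1) that by simp
    show "(\<Sum>k<length ps. snd (ps ! k) - fst (ps ! k)) < \<delta>"
      using ps(3) by (simp add: sum_list_sum_nth atLeast0LessThan)
    show "disjoint_family_on (\<lambda>k. {fst (ps ! k)<..<snd (ps ! k)}) {..<length ps}"
      unfolding disjoint_family_on_def
    proof (intro ballI impI)
      fix m n assume mn: "m \<in> {..<length ps}" "n \<in> {..<length ps}" "m \<noteq> n"
      then consider "m < n" | "n < m" by linarith
      then show "{fst (ps ! m)<..<snd (ps ! m)} \<inter> {fst (ps ! n)<..<snd (ps ! n)} = {}"
      proof cases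
        case 1
        then show ?thesis using sorted_wrt_nth_less[OF ps(2) 1] mn by auto
      next
        case 2
        then show ?thesis using sorted_wrt_nth_less[OF ps(2) 2] mn by auto
      qed
    qed
  qed
  then show ?thesis by (simp add: sum_list_sum_nth atLeast0LessThan)
qed

definition links :: "real list \<Rightarrow> (real \<times> real) list"
  where "links xs = zip xs (tl xs)"

lemma links_simps [simp]: "links [] = []" "links [x] = []" "links (x # y # zs) = (x, y) # links (y # zs)"
  by (auto simp: links_def)

lemma sum_links: "(\<Sum>p\<leftarrow>links xs. norm (f (snd p) - f (fst p))) = chord_sum f xs"
  by (induction f xs rule: chord_sum.induct) auto

lemma links_chain:
  assumes "xs \<in> partitions a b" "p \<in> set (links xs)"
  shows "a \<le> fst p" "fst p \<le> snd p" "snd p \<le> b"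
  using assms by (induction xs rule: induct_list012) (auto simp: partitions_def)

lemma links_nonoverlapping: "sorted xs \<Longrightarrow> sorted_wrt (\<lambda>p q. nonoverlapping p q) (links xs)"
proof (induction xs rule: induct_list012)
  case (3 x y zs)
  have "y \<le> fst p" if "p \<in> set (links (y # zs))" for p
  proof -
    have "fst p \<in> set (y # zs)" using that unfolding links_def by (metis prod.collapse set_zip_leftD)
    then show ?thesis using 3 by auto
  qed
  then show ?case using 3 by fastforce
qed auto

lemma sum_links_length: "sorted xs \<Longrightarrow> set xs \<subseteq> {a..b} \<Longrightarrow> a \<le> b \<Longrightarrow> (\<Sum>p\<leftarrow>links xs. snd p - fst p) \<le> b - a"
  by (induction xs arbitrary: a rule: induct_list012) force+

text \<open>Replacing each interval by the links of a partition of it gives again a nonoverlapping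
  family, of no larger total length, so the same \<delta> serves for the refined sums. Through this
  the variation inherits absolute continuity.\<close>

lemma ac_modulus_chord_sum:
  fixes n :: nat
  assumes "ac_modulus S f \<epsilon> \<delta>"
    and uv: "\<And>k. k < n \<Longrightarrow> u k \<le> v k \<and> {u k..v k} \<subseteq> S"
    and disj: "disjoint_family_on (\<lambda>k. {u k<..<v k}) {..<n}"
    and len: "(\<Sum>k<n. v k - u k) < \<delta>" and xs: "\<And>k. k < n \<Longrightarrow> xs k \<in> partitions (u k) (v k)"
  shows "(\<Sum>k<n. chord_sum f (xs k)) < \<epsilon>"
proof -
    \<comment> \<open>All links of the first \<open>m\<close> partitions in one list; nonoverlap and
      total length are then shown by induction on \<open>m\<close>.\<close>
    define ps where "ps m = concat (map (\<lambda>k. links (xs k)) [0..<m])" for m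
    have ps_Suc: "ps (Suc m) = ps m @ links (xs m)" for m by (simp add: ps_def)
    have set_ps: "set (ps m) = (\<Union>k<m. set (links (xs k)))" for m
      by (auto simp: ps_def)
    have bnd: "u k \<le> fst p" "fst p \<le> snd p" "snd p \<le> v k" if "k < n" "p \<in> set (links (xs k))" for k p
      using links_chain[OF xs] that by auto
    have "sorted_wrt (\<lambda>p q. nonoverlapping p q) (ps m)" if "m \<le> n" for m
      using that
    proof (induction m)
      case 0
      then show ?case by (simp add: ps_def)
    next
      case (Suc m)
      have "nonoverlapping p q" if pq: "p \<in> set (ps m)" "q \<in> set (links (xs m))" for p q
      proof -
        obtain k where k: "k < m" "p \<in> set (links (xs k))" using pq(1) unfolding set_ps by blast
        have "{u k<..<v k} \<inter> {u m<..<v m} = {}"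
          using disj k Suc(2) by (auto simp: disjoint_family_on_def)
        moreover have "{fst p<..<snd p} \<subseteq> {u k<..<v k}" "{fst q<..<snd q} \<subseteq> {u m<..<v m}"
          using bnd[of k p] bnd[of m q] k pq Suc(2) by auto
        ultimately show ?thesis by blast
      qed
      moreover have "sorted_wrt (\<lambda>p q. nonoverlapping p q) (links (xs m))"
        using links_nonoverlapping xs[of m] Suc(2) by (auto simp: partitions_def)
      ultimately show ?case using Suc by (auto simp: ps_Suc sorted_wrt_append)
    qed
    moreover have "(\<Sum>p\<leftarrow>ps m. snd p - fst p) \<le> (\<Sum>k<m. v k - u k)" if "m \<le> n" for m
      using that
    proof (induction m)
      case 0
      then show ?case by (simp add: ps_def)
    next
      case (Suc m)
      then show ?case using sum_links_length[of "xs m" "u m" "v m"] xs[of m] uv[of m]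
        by (auto simp: ps_Suc partitions_def)
    qed
    moreover have "fst p \<le> snd p \<and> {fst p..snd p} \<subseteq> S" if pn: "p \<in> set (ps n)" for p
    proof -
      obtain k where k: "k < n" "p \<in> set (links (xs k))" using pn unfolding set_ps by blast
      then show ?thesis using bnd[OF k] uv[of k] by auto
    qed
    ultimately have "(\<Sum>p\<leftarrow>ps n. norm (f (snd p) - f (fst p))) < \<epsilon>"
      using len by (intro ac_modulus_list[OF assms(1)]) (auto intro: le_less_trans)
    moreover have "(\<Sum>p\<leftarrow>ps m. norm (f (snd p) - f (fst p))) = (\<Sum>k<m. chord_sum f (xs k))" for m
      by (induction m) (auto simp: ps_Suc sum_links, simp add: ps_def)
    ultimately show "(\<Sum>k<n. chord_sum f (xs k)) < \<epsilon>" by simp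
qed

text \<open>On a piece shorter than the \<delta> belonging to \<epsilon> = 1 all chord sums are at
  most 1, and finitely many such pieces are joined by \<open>variation_combine\<close>.\<close>

lemma absolutely_continuous_on_imp_bounded_variation:
  assumes ac: "absolutely_continuous_on {a..b} f"
  shows "bounded_variation f a b"
proof (cases "a \<le> b")
  case True
  obtain \<delta> where \<delta>: "0 < \<delta>" "ac_modulus {a..b} f 1 \<delta>"
    using ac zero_less_one unfolding absolutely_continuous_on_iff_modulus by blast
  have short: "bounded_variation f u v" if "a \<le> u" "u \<le> v" "v \<le> b" "v - u < \<delta>" for u v
  proof (rule bounded_variationI)
    fix xs assume "xs \<in> partitions u v"
    then show "chord_sum f xs \<le> 1"
      using ac_modulus_chord_sum[OF \<delta>(2), of 1 "\<lambda>_. u" "\<lambda>_. v" "\<lambda>_. xs"] that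
      by (simp add: disjoint_family_on_def)
  qed
  \<comment> \<open>Advance in steps of \<open>\<delta> / 2\<close>, strictly shorter than \<delta>;
    the minimum stops the march at \<open>b\<close>.\<close>
  have "bounded_variation f a (min b (a + real k * (\<delta> / 2)))" for k
  proof (induction k)
    case 0
    then show ?case using short[of a a] True \<delta>(1) by simp
  next
    case (Suc k)
    let ?c = "min b (a + real k * (\<delta> / 2))" and ?d = "min b (a + real (Suc k) * (\<delta> / 2))"
    have "a \<le> ?c" "?c \<le> ?d" "?d \<le> b" "?d - ?c < \<delta>"
    proof -
      have "real (Suc k) * (\<delta> / 2) = real k * (\<delta> / 2) + \<delta> / 2" "0 \<le> real k * (\<delta> / 2)"
        using \<delta>(1) by (auto simp: algebra_simps)
      then show "a \<le> ?c" "?c \<le> ?d" "?d \<le> b" "?d - ?c < \<delta>" using True \<delta>(1) by linarith+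
    qed
    then show ?case using variation_combine(1)[OF Suc.IH short] by blast
  qed
  moreover obtain k where "(b - a) / (\<delta> / 2) < real k" using reals_Archimedean2 by blast
  then have "min b (a + real k * (\<delta> / 2)) = b" using \<delta>(1) by (simp add: field_simps)
  ultimately show ?thesis by metis
next
  case False
  then have "partitions a b \<subseteq> {[]}" by (auto simp: partitions_def)
  then show ?thesis by (intro bounded_variationI[where B=0]) auto
qed

text \<open>The increment of the variation over an interval is the variation there, hence nearly a
  chord sum. Refining all intervals at once reduces the claim to
  \<open>ac_modulus_chord_sum\<close>.\<close>

lemma absolutely_continuous_on_variation:
  assumes ac: "absolutely_continuous_on {a..b} f"
  shows "absolutely_continuous_on {a..b} (variation f a)"
  unfolding absolutely_continuous_on_iff_modulus
proof (intro allI impI)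
  fix \<epsilon> :: real assume \<epsilon>: "0 < \<epsilon>"
  have bv: "bounded_variation f s t" if "a \<le> s" "t \<le> b" for s t
    using absolutely_continuous_on_imp_bounded_variation[OF ac] that bounded_variation_subset by blast
  obtain \<delta> where \<delta>: "0 < \<delta>" "ac_modulus {a..b} f (\<epsilon> / 2) \<delta>"
    using ac \<epsilon> half_gt_zero unfolding absolutely_continuous_on_iff_modulus by blast
  have "ac_modulus {a..b} (variation f a) \<epsilon> \<delta>"
  proof (rule ac_modulusI)
    fix n :: nat and u v
    assume uv: "\<And>k. k < n \<Longrightarrow> u k \<le> v k \<and> {u k..v k} \<subseteq> {a..b}"
      and disj: "disjoint_family_on (\<lambda>k. {u k<..<v k}) {..<n}" and len: "(\<Sum>k<n. v k - u k) < \<delta>"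
    \<comment> \<open>Half of \<epsilon> pays for the \<open>n\<close> approximation errors \<eta>,
      half for the refined chord sums; \<open>n + 1\<close> covers \<open>n = 0\<close>.\<close>
    define \<eta> where "\<eta> = \<epsilon> / (2 * (real n + 1))"
    have \<eta>: "0 < \<eta>" using \<epsilon> by (simp add: \<eta>_def)
    have "\<exists>xs. xs \<in> partitions (u k) (v k) \<and> norm (variation f a (v k) - variation f a (u k)) - \<eta> < chord_sum f xs"
      if "k < n" for k
    proof -
      have k: "a \<le> u k" "u k \<le> v k" "v k \<le> b" using uv[OF that] by auto
      have "variation f a (u k) + variation f (u k) (v k) = variation f a (v k)"
        by (rule variation_combine(2)) (use bv k in auto)
      moreover have "0 \<le> variation f (u k) (v k)" using variation_nonneg bv k by blast
      ultimately have "norm (variation f a (v k) - variation f a (u k)) = variation f (u k) (v k)" by simp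
      moreover obtain xs where "xs \<in> partitions (u k) (v k)" "variation f (u k) (v k) - \<eta> < chord_sum f xs"
        using variation_approx[of f "u k" "v k" \<eta>] bv k \<eta> by auto
      ultimately show ?thesis by metis
    qed
    then obtain xs where xs: "\<And>k. k < n \<Longrightarrow> xs k \<in> partitions (u k) (v k)"
      "\<And>k. k < n \<Longrightarrow> norm (variation f a (v k) - variation f a (u k)) - \<eta> < chord_sum f (xs k)"
      by metis
    have "(\<Sum>k<n. norm (variation f a (v k) - variation f a (u k))) \<le> (\<Sum>k<n. chord_sum f (xs k) + \<eta>)"
    proof (rule sum_mono)
      fix k assume "k \<in> {..<n}"
      then show "norm (variation f a (v k) - variation f a (u k)) \<le> chord_sum f (xs k) + \<eta>"
        using xs(2)[of k] by simp
    qed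
    also have "\<dots> = (\<Sum>k<n. chord_sum f (xs k)) + real n * \<eta>"
      by (simp add: sum.distrib)
    also have "real n * \<eta> \<le> \<epsilon> / 2" using \<epsilon> by (simp add: \<eta>_def field_simps)
    also have "(\<Sum>k<n. chord_sum f (xs k)) < \<epsilon> / 2"
      using ac_modulus_chord_sum[OF \<delta>(2) uv disj len xs(1)] by blast
    finally show "(\<Sum>k<n. norm (variation f a (v k) - variation f a (u k))) < \<epsilon>" by simp
  qed
  with \<delta>(1) show "\<exists>\<delta>>0. ac_modulus {a..b} (variation f a) \<epsilon> \<delta>" by blast
qed

section \<open>The fundamental theorem of calculus\<close>

lemma absolutely_continuous_on_dominated:
  assumes "absolutely_continuous_on S G" "0 < C"
    and "\<And>u v. u \<le> v \<Longrightarrow> {u..v} \<subseteq> S \<Longrightarrow> norm (g v - g u) \<le> C * norm (G v - G u)"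
  shows "absolutely_continuous_on S g"
  unfolding absolutely_continuous_on_iff_modulus
proof (intro allI impI)
  fix \<epsilon> :: real assume "0 < \<epsilon>"
  then have "0 < \<epsilon> / C" using assms(2) by simp
  then obtain \<delta> where \<delta>: "0 < \<delta>" "ac_modulus S G (\<epsilon> / C) \<delta>"
    using assms(1) unfolding absolutely_continuous_on_iff_modulus by blast
  have "ac_modulus S g \<epsilon> \<delta>"
  proof (rule ac_modulusI)
    fix n :: nat and a b
    assume ab: "\<And>k. k < n \<Longrightarrow> a k \<le> b k \<and> {a k..b k} \<subseteq> S"
      "disjoint_family_on (\<lambda>k. {a k<..<b k}) {..<n}" "(\<Sum>k<n. b k - a k) < \<delta>"
    have "(\<Sum>k<n. norm (g (b k) - g (a k))) \<le> (\<Sum>k<n. C * norm (G (b k) - G (a k)))"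
      by (rule sum_mono) (use assms(3) ab(1) in auto)
    also have "\<dots> = C * (\<Sum>k<n. norm (G (b k) - G (a k)))" by (simp add: sum_distrib_left)
    also have "\<dots> < C * (\<epsilon> / C)"
      by (rule mult_strict_left_mono[OF ac_modulusD[OF \<delta>(2) ab] assms(2)])
    finally show "(\<Sum>k<n. norm (g (b k) - g (a k))) < \<epsilon>" using assms(2) by simp
  qed
  with \<delta>(1) show "\<exists>\<delta>>0. ac_modulus S g \<epsilon> \<delta>" by blast
qed

text \<open>Outer covers come as sets of intervals with a bound on the measure of their union;
  nonoverlap turns that measure into the sum of lengths that the modulus speaks of.\<close>

lemma ac_modulus_Union_intervals:
  fixes F :: "real \<Rightarrow> real"
  assumes ac: "ac_modulus UNIV F \<epsilon> \<delta>" and "finite \<D>"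
    and iv: "\<And>K. K \<in> \<D> \<Longrightarrow> K \<noteq> {} \<and> (\<exists>c d. K = {c..d})"
    and disj: "pairwise (\<lambda>A B. interior A \<inter> interior B = {}) \<D>"
    and small: "measure lebesgue (\<Union>\<D>) < \<delta>"
  shows "(\<Sum>K\<in>\<D>. norm (F (Sup K) - F (Inf K))) < \<epsilon>"
proof -
  obtain h where h: "bij_betw h {..<card \<D>} \<D>"
    using ex_bij_betw_nat_finite[OF \<open>finite \<D>\<close>] by (auto simp: atLeast0LessThan)
  have K: "Inf K \<le> Sup K \<and> K = {Inf K..Sup K}" if "K \<in> \<D>" for K
    using iv[OF that] by auto
  have "(\<Sum>k<card \<D>. norm (F (Sup (h k)) - F (Inf (h k)))) < \<epsilon>"
  proof (rule ac_modulusD[OF ac])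
    show "Inf (h k) \<le> Sup (h k) \<and> {Inf (h k)..Sup (h k)} \<subseteq> UNIV" if "k < card \<D>" for k
      using K[of "h k"] h that by (auto simp: bij_betw_def)
    have int: "interior (h k) = {Inf (h k)<..<Sup (h k)}" if "k < card \<D>" for k
    proof -
      have "h k \<in> \<D>" using h that by (auto simp: bij_betw_def)
      then show ?thesis using K[of "h k"] interior_atLeastAtMost_real[of "Inf (h k)" "Sup (h k)"] by simp
    qed
    show "disjoint_family_on (\<lambda>k. {Inf (h k)<..<Sup (h k)}) {..<card \<D>}"
      unfolding disjoint_family_on_def
    proof (intro ballI impI)
      fix m n assume mn: "m \<in> {..<card \<D>}" "n \<in> {..<card \<D>}" "m \<noteq> n"
      then have "h m \<in> \<D>" "h n \<in> \<D>" "h m \<noteq> h n" using h by (auto simp: bij_betw_def inj_on_def)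
      with disj have "interior (h m) \<inter> interior (h n) = {}" by (simp add: pairwise_def)
      then show "{Inf (h m)<..<Sup (h m)} \<inter> {Inf (h n)<..<Sup (h n)} = {}" using int mn by simp
    qed
    have "measure lebesgue (\<Union>\<D>) = (\<Sum>K\<in>\<D>. measure lebesgue K)"
    proof (rule measure_negligible_finite_Union[OF \<open>finite \<D>\<close>])
      show "K \<in> lmeasurable" if "K \<in> \<D>" for K
        using iv[OF that] by (metis lmeasurable_cbox cbox_interval)
      show "pairwise (\<lambda>S T. negligible (S \<inter> T)) \<D>"
        unfolding pairwise_def
      proof (intro ballI impI)
        fix S T assume ST: "S \<in> \<D>" "T \<in> \<D>" "S \<noteq> T"
        \<comment> \<open>The two intervals may share an endpoint, but a convex set with empty
          interior is negligible.\<close>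
        then have "interior (S \<inter> T) = {}" using disj by (simp add: pairwise_def interior_Int)
        moreover have "convex (S \<inter> T)" using iv[OF ST(1)] iv[OF ST(2)] by (auto intro!: convex_Int)
        ultimately show "negligible (S \<inter> T)" by (simp add: negligible_convex_interior)
      qed
    qed
    also have "\<dots> = (\<Sum>K\<in>\<D>. Sup K - Inf K)"
    proof (rule sum.cong[OF refl])
      fix K' assume "K' \<in> \<D>"
      then show "measure lebesgue K' = Sup K' - Inf K'"
        using iv[of K'] by (auto simp: measure_completion)
    qed
    also have "\<dots> = (\<Sum>k<card \<D>. Sup (h k) - Inf (h k))"
      by (rule sum.reindex_bij_betw[OF h, symmetric])
    finally show "(\<Sum>k<card \<D>. Sup (h k) - Inf (h k)) < \<delta>" using small by simp
  qed
  also have "(\<Sum>k<card \<D>. norm (F (Sup (h k)) - F (Inf (h k)))) = (\<Sum>K\<in>\<D>. norm (F (Sup K) - F (Inf K)))"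
    by (rule sum.reindex_bij_betw[OF h])
  finally show ?thesis .
qed

text \<open>A bounded null set lies in countably many nonoverlapping intervals of total length below
  \<delta>. Finite subfamilies have total \<open>F\<close>-increment below \<epsilon>, and
  continuity of the measure from below carries this to the whole cover.\<close>

lemma interval_measure_absolutely_continuous:
  fixes F :: "real \<Rightarrow> real"
  assumes mono: "\<And>x y. x \<le> y \<Longrightarrow> F x \<le> F y" and cont: "continuous_on UNIV F"
    and ac: "absolutely_continuous_on UNIV F"
  shows "absolutely_continuous lborel (interval_measure F)"
  unfolding absolutely_continuous_def
proof
  let ?\<mu> = "interval_measure F"
  fix N :: "real set" assume N: "N \<in> null_sets lborel"
  \<comment> \<open>The covering result works inside a bounded box, so the null set is first cut to
    \<open>[-m, m]\<close>.\<close>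
  have Nm: "N \<inter> {-real m..real m} \<in> null_sets ?\<mu>" for m
  proof -
    let ?N = "N \<inter> {-real m..real m}"
    have N': "?N \<in> null_sets lborel" using N by (intro null_set_Int2) auto
    then have Nb: "?N \<in> sets borel" by auto
    have "emeasure ?\<mu> ?N \<le> 0 + ennreal \<epsilon>" if \<epsilon>: "0 < \<epsilon>" for \<epsilon>
    proof -
      obtain \<delta> where \<delta>: "0 < \<delta>" "ac_modulus UNIV F \<epsilon> \<delta>"
        using ac \<epsilon> unfolding absolutely_continuous_on_iff_modulus by blast
      have Nl: "?N \<in> null_sets lebesgue" using N' by (rule null_sets_completionI)
      then have lm: "?N \<in> lmeasurable" "measure lebesgue ?N = 0"
        by (auto simp: negligible_iff_null_sets[symmetric] negligible_iff_measure)
      show ?thesis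
      proof (rule measurable_outer_intervals_bounded[OF lm(1), of "-real m" "real m" "\<delta> / 2"])
        show "?N \<subseteq> cbox (-real m) (real m)" "0 < \<delta> / 2" using \<delta>(1) by auto
        fix \<D> assume \<D>: "countable \<D>"
          "\<And>K. K \<in> \<D> \<Longrightarrow> K \<subseteq> cbox (-real m) (real m) \<and> K \<noteq> {} \<and> (\<exists>c d. K = cbox c d)"
          "pairwise (\<lambda>A B. interior A \<inter> interior B = {}) \<D>"
          "?N \<subseteq> \<Union>\<D>" "\<Union>\<D> \<in> lmeasurable"
          "measure lebesgue (\<Union>\<D>) \<le> measure lebesgue ?N + \<delta> / 2"
        show ?thesis
        proof (cases "\<D> = {}")
          case True
          then have "?N = {}" using \<D>(4) by simp
          then show ?thesis by simp
        next
          case False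
          \<comment> \<open>This enumeration repeats members when \<open>\<D>\<close> is finite; the
            sums below therefore run over image sets.\<close>
          define E where "E = from_nat_into \<D>"
          have E: "range E = \<D>" unfolding E_def by (rule range_from_nat_into[OF False \<D>(1)])
          have sE: "E k \<in> sets ?\<mu>" for k
          proof -
            have "E k \<in> \<D>" using E by blast
            then obtain c d where "E k = cbox c d" using \<D>(2) by blast
            then show ?thesis by simp
          qed
          have "emeasure ?\<mu> ?N \<le> emeasure ?\<mu> (\<Union>n. \<Union>k<n. E k)"
          proof (rule emeasure_mono)
            have "(\<Union>n. \<Union>k<n. E k) = (\<Union>k. E k)" by auto
            then show "?N \<subseteq> (\<Union>n. \<Union>k<n. E k)" using \<D>(4) E by simp
            show "(\<Union>n. \<Union>k<n. E k) \<in> sets ?\<mu>" using sE by (intro sets.countable_UN' sets.finite_UN) auto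
          qed
          also have "\<dots> = (SUP n. emeasure ?\<mu> (\<Union>k<n. E k))"
          proof (rule SUP_emeasure_incseq[symmetric])
            show "range (\<lambda>n. \<Union>k<n. E k) \<subseteq> sets ?\<mu>" using sE by (auto intro!: sets.finite_UN)
            show "incseq (\<lambda>n. \<Union>k<n. E k)" by (intro monoI UN_mono) auto
          qed
          also have "\<dots> \<le> ennreal \<epsilon>"
          proof (rule SUP_least)
            fix n
            have sub: "E ` {..<n} \<subseteq> \<D>" using E by auto
            have "emeasure ?\<mu> (\<Union>k<n. E k) \<le> (\<Sum>K\<in>E ` {..<n}. emeasure ?\<mu> K)"
              using emeasure_subadditive_finite[of "E ` {..<n}" id ?\<mu>] sE by auto
            also have "\<dots> = (\<Sum>K\<in>E ` {..<n}. ennreal (norm (F (Sup K) - F (Inf K))))"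
            proof (rule sum.cong[OF refl])
              fix K assume "K \<in> E ` {..<n}"
              then have "K \<in> \<D>" using sub by blast
              from \<D>(2)[OF this] obtain c d where K: "K = {c..d}" "c \<le> d" by auto
              then show "emeasure ?\<mu> K = ennreal (norm (F (Sup K) - F (Inf K)))"
                using emeasure_interval_measure_Icc[OF K(2) mono cont] mono[OF K(2)] by simp
            qed
            also have "\<dots> = ennreal (\<Sum>K\<in>E ` {..<n}. norm (F (Sup K) - F (Inf K)))"
              by (rule sum_ennreal) simp
            also have "\<dots> \<le> ennreal \<epsilon>"
            proof (rule ennreal_leI, rule less_imp_le, rule ac_modulus_Union_intervals[OF \<delta>(2)])
              show "K \<noteq> {} \<and> (\<exists>c d. K = {c..d})" if "K \<in> E ` {..<n}" for K
                using \<D>(2)[of K] sub that by auto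
              show "pairwise (\<lambda>A B. interior A \<inter> interior B = {}) (E ` {..<n})"
                using \<D>(3) sub unfolding pairwise_def by blast
              have "measure lebesgue (\<Union>(E ` {..<n})) \<le> measure lebesgue (\<Union>\<D>)"
              proof (rule measure_mono_fmeasurable[OF _ _ \<D>(5)])
                show "\<Union>(E ` {..<n}) \<subseteq> \<Union>\<D>" using sub by blast
                show "\<Union>(E ` {..<n}) \<in> sets lebesgue"
                  using sE by (intro sets.finite_UN) (auto intro: sets_completionI_sets)
              qed
              then show "measure lebesgue (\<Union>(E ` {..<n})) < \<delta>" using \<D>(6) \<delta>(1) lm(2) by simp
            qed simp
            finally show "emeasure ?\<mu> (\<Union>k<n. E k) \<le> ennreal \<epsilon>" .
          qed
          finally show ?thesis by simp
        qed
      qed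
    qed
    then have "emeasure ?\<mu> ?N \<le> 0" by (rule ennreal_le_epsilon)
    then show ?thesis using Nb by (intro null_setsI) auto
  qed
  have "(\<Union>m. N \<inter> {-real m..real m}) = N"
  proof (rule sym, rule equalityI)
    show "N \<subseteq> (\<Union>m. N \<inter> {-real m..real m})"
    proof
      fix x assume "x \<in> N"
      moreover obtain m where "\<bar>x\<bar> \<le> real m" using real_arch_simple by blast
      ultimately show "x \<in> (\<Union>m. N \<inter> {-real m..real m})" by (auto intro!: exI[of _ m])
    qed
  qed auto
  moreover have "(\<Union>m. N \<inter> {-real m..real m}) \<in> null_sets ?\<mu>" using Nm by (rule null_sets_UN)
  ultimately show "N \<in> null_sets ?\<mu>" by simp
qed

text \<open>The bounds on \<open>F\<close> make the Stieltjes measure finite. This gives its density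
  a real-valued version and makes it integrable over the whole line.\<close>

lemma absolutely_continuous_mono_density:
  fixes F :: "real \<Rightarrow> real"
  assumes mono: "\<And>x y. x \<le> y \<Longrightarrow> F x \<le> F y" and cont: "continuous_on UNIV F"
    and ac: "absolutely_continuous_on UNIV F" and bnd: "\<And>x. A \<le> F x" "\<And>x. F x \<le> B"
  obtains D where "D absolutely_integrable_on UNIV" "\<And>x. 0 \<le> D x"
    "\<And>s t. s \<le> t \<Longrightarrow> (D has_integral F t - F s) {s..t}"
proof -
  let ?\<mu> = "interval_measure F"
  have Icc: "emeasure ?\<mu> {s..t} = ennreal (F t - F s)" if "s \<le> t" for s t
    using emeasure_interval_measure_Icc[OF that mono cont] .
  have "UNIV = (\<Union>n. {-real n..real n})"
  proof (rule UNIV_eq_I)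
    fix x :: real
    obtain m where "\<bar>x\<bar> \<le> real m" using real_arch_simple by blast
    then show "x \<in> (\<Union>n. {-real n..real n})" by (auto intro!: exI[of _ m])
  qed
  then have "emeasure ?\<mu> UNIV = emeasure ?\<mu> (\<Union>n. {-real n..real n})" by simp
  also have "\<dots> = (SUP n. emeasure ?\<mu> {-real n..real n})"
    by (rule SUP_emeasure_incseq[symmetric]) (auto simp: incseq_def)
  also have "\<dots> \<le> ennreal (B - A)"
    using bnd by (intro SUP_least) (auto simp: Icc intro!: ennreal_leI diff_mono)
  finally have fin: "emeasure ?\<mu> UNIV \<le> ennreal (B - A)" .
  have "finite_measure ?\<mu>"
    using fin by (intro finite_measureI) (auto simp: top_unique)
  have abs: "absolutely_continuous lborel ?\<mu>"
    by (rule interval_measure_absolutely_continuous[OF mono cont ac])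
  obtain D where D: "D \<in> borel_measurable lborel"
    "AE x in lborel. RN_deriv lborel ?\<mu> x = ennreal (D x)" "\<And>x. 0 \<le> D x"
  proof (rule sigma_finite_measure.real_RN_deriv[OF sigma_finite_lborel \<open>finite_measure ?\<mu>\<close> abs])
    show "sets ?\<mu> = sets lborel" by simp
    fix D assume "D \<in> borel_measurable lborel"
      "AE x in lborel. RN_deriv lborel ?\<mu> x = ennreal (D x)" "\<And>x. 0 \<le> D x"
    then show thesis by (rule that)
  qed
  have "density lborel (\<lambda>x. ennreal (D x)) = density lborel (RN_deriv lborel ?\<mu>)"
    using D by (intro density_cong) auto
  also have "\<dots> = ?\<mu>" by (rule sigma_finite_measure.density_RN_deriv[OF sigma_finite_lborel abs]) simp
  finally have dens: "density lborel (\<lambda>x. ennreal (D x)) = ?\<mu>" .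
  have em: "(\<integral>\<^sup>+x. ennreal (D x) * indicator S x \<partial>lborel) = emeasure ?\<mu> S" if "S \<in> sets borel" for S
    using D(1) that by (simp add: dens[symmetric] emeasure_density)
  have "integrable lborel D"
    using em[of UNIV] fin D by (intro integrableI_nonneg) (auto simp: less_top[symmetric] top_unique)
  then have "D absolutely_integrable_on UNIV"
    using D(1) by (simp add: set_integrable_def integrable_completion)
  moreover have "(D has_integral F t - F s) {s..t}" if "s \<le> t" for s t
  proof -
    have "has_bochner_integral lborel (\<lambda>x. D x * indicator {s..t} x) (F t - F s)"
    proof (rule has_bochner_integral_nn_integral)
      show "(\<integral>\<^sup>+x. ennreal (D x * indicator {s..t} x) \<partial>lborel) = ennreal (F t - F s)"
        using em[of "{s..t}"] Icc[OF that] D(3)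
        by (simp add: ennreal_mult' ennreal_indicator)
    qed (use D mono[OF that] in auto)
    then have "((\<lambda>x. D x * indicator {s..t} x) has_integral F t - F s) UNIV"
      unfolding has_bochner_integral_iff using has_integral_integral_lborel by metis
    also have "(\<lambda>x. D x * indicator {s..t} x) = (\<lambda>x. if x \<in> {s..t} then D x else 0)"
      by (auto simp: indicator_def)
    finally show ?thesis by (simp only: has_integral_restrict_UNIV)
  qed
  ultimately show ?thesis using that D(3) by blast
qed


lemma absolutely_continuous_on_variationI:
  fixes f :: "real \<Rightarrow> 'a::real_normed_vector"
  assumes "absolutely_continuous_on {a..b} f" "a \<le> s" "t \<le> b"
  shows "bounded_variation f s t"
  using absolutely_continuous_on_imp_bounded_variation[OF assms(1)] assms(2,3)
  by (rule bounded_variation_subset)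

text \<open>Jordan decomposition by coordinates: with \<open>V\<close> the variation function, both
  \<open>V\<close> and \<open>V - f \<bullet> e\<close> are nondecreasing and absolutely continuous.
  Both have densities, and their difference is a density for \<open>f \<bullet> e\<close>.\<close>

lemma absolutely_continuous_on_imp_density:
  fixes f :: "real \<Rightarrow> 'a::euclidean_space"
  assumes ac: "absolutely_continuous_on {a..b} f" and "a \<le> b"
  obtains \<phi> where "\<phi> absolutely_integrable_on UNIV"
    "\<And>s t. a \<le> s \<Longrightarrow> s \<le> t \<Longrightarrow> t \<le> b \<Longrightarrow> (\<phi> has_integral f t - f s) {s..t}"
proof -
  define c where "c t = max a (min b t)" for t
  have c: "a \<le> c t" "c t \<le> b" "s \<le> t \<Longrightarrow> c s \<le> c t" for s t using \<open>a \<le> b\<close> by (auto simp: c_def)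
  define V where "V t = variation f a (c t)" for t
  have V_diff: "V t - V s = variation f (c s) (c t)" "norm (f (c t) - f (c s)) \<le> V t - V s" if "s \<le> t" for s t
  proof -
    have bv: "bounded_variation f u v" if "a \<le> u" "v \<le> b" for u v
      using ac that by (rule absolutely_continuous_on_variationI)
    show "V t - V s = variation f (c s) (c t)"
      using variation_combine(2)[of f a "c s" "c t"] bv c that by (simp add: V_def)
    then show "norm (f (c t) - f (c s)) \<le> V t - V s"
      using norm_diff_le_variation[of f "c s" "c t"] bv c that by simp
  qed
  have acV: "absolutely_continuous_on UNIV V"
    unfolding V_def c_def
    using absolutely_continuous_on_clamp[OF absolutely_continuous_on_variation[OF ac] \<open>a \<le> b\<close>] .
  \<comment> \<open>The factor 2 is for \<open>V - f \<bullet> e\<close>, whose increments are at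
    most those of \<open>V\<close> plus the norm of the increment of \<open>f\<close>. The condition
    \<open>G (c t) = G t\<close> bounds \<open>G\<close> by its values at \<open>a\<close> and
    \<open>b\<close>.\<close>
  have density: "\<exists>D. D absolutely_integrable_on UNIV \<and> (\<forall>s t. s \<le> t \<longrightarrow> (D has_integral G t - G s) {s..t})"
    if G: "\<And>s t. s \<le> t \<Longrightarrow> 0 \<le> G t - G s \<and> G t - G s \<le> 2 * (V t - V s)" "\<And>t. G (c t) = G t" for G
  proof -
    have mono: "G s \<le> G t" if "s \<le> t" for s t using G(1)[OF that] by simp
    have acG: "absolutely_continuous_on UNIV G"
    proof (rule absolutely_continuous_on_dominated[OF acV, of 2])
      fix u v :: real assume "u \<le> v"
      then show "norm (G v - G u) \<le> 2 * norm (V v - V u)" using G(1)[of u v] by auto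
    qed simp
    have contG: "continuous_on UNIV G"
    proof (rule continuous_on_subset[of "\<Union>n. {-real n<..<real n}"])
      show "continuous_on (\<Union>n. {-real n<..<real n}) G"
      proof (rule continuous_on_open_UN)
        show "continuous_on {-real n<..<real n} G" for n
          using absolutely_continuous_on_imp_continuous_on[OF absolutely_continuous_on_subset[OF acG, of "{-real n..real n}"]]
          by (rule continuous_on_subset) auto
      qed auto
      show "UNIV \<subseteq> (\<Union>n. {-real n<..<real n})"
      proof
        fix x :: real
        obtain m where "\<bar>x\<bar> < real m" using reals_Archimedean2 by blast
        then show "x \<in> (\<Union>n. {-real n<..<real n})" by (auto intro!: exI[of _ m])
      qed
    qed
    have "G a \<le> G x" "G x \<le> G b" for x using mono[OF c(1)[of x]] mono[OF c(2)[of x]] G(2) by auto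
    then show ?thesis
      using absolutely_continuous_mono_density[OF mono contG acG] by metis
  qed
  have cc: "c (c t) = c t" for t using c by (simp add: c_def)
  have "\<exists>D. D absolutely_integrable_on UNIV \<and> (\<forall>s t. s \<le> t \<longrightarrow> (D has_integral V t - V s) {s..t})"
  proof (rule density)
    show "0 \<le> V t - V s \<and> V t - V s \<le> 2 * (V t - V s)" if "s \<le> t" for s t
      using order_trans[OF norm_ge_zero V_diff(2)[OF that]] by simp
  qed (simp add: V_def cc)
  then obtain D where D: "D absolutely_integrable_on UNIV"
    "\<And>s t. s \<le> t \<Longrightarrow> (D has_integral V t - V s) {s..t}" by blast
  have "\<exists>D. D absolutely_integrable_on UNIV \<and>
      (\<forall>s t. s \<le> t \<longrightarrow> (D has_integral (V t - f (c t) \<bullet> e) - (V s - f (c s) \<bullet> e)) {s..t})"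
    if e: "e \<in> Basis" for e
  proof (rule density)
    show "0 \<le> (V t - f (c t) \<bullet> e) - (V s - f (c s) \<bullet> e) \<and>
      (V t - f (c t) \<bullet> e) - (V s - f (c s) \<bullet> e) \<le> 2 * (V t - V s)" if "s \<le> t" for s t
      using V_diff(2)[OF that] Basis_le_norm[OF e, of "f (c t) - f (c s)"] by (auto simp: inner_diff_left)
  qed (simp add: V_def cc)
  then obtain E where E: "\<And>e. e \<in> Basis \<Longrightarrow> E e absolutely_integrable_on UNIV"
    "\<And>e s t. e \<in> Basis \<Longrightarrow> s \<le> t \<Longrightarrow> (E e has_integral (V t - f (c t) \<bullet> e) - (V s - f (c s) \<bullet> e)) {s..t}"
    by metis
  define \<phi> where "\<phi> x = (\<Sum>e\<in>Basis. (D x - E e x) *\<^sub>R e)" for x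
  have "\<phi> absolutely_integrable_on UNIV"
    unfolding \<phi>_def
    by (intro absolutely_integrable_sum absolutely_integrable_scaleR_right
          absolutely_integrable_scaleR_left set_integral_diff(1) D(1) E(1)) auto
  moreover have "(\<phi> has_integral f t - f s) {s..t}" if st: "a \<le> s" "s \<le> t" "t \<le> b" for s t
  proof -
    have cst: "c s = s" "c t = t" using st by (auto simp: c_def)
    have "(\<phi> has_integral (\<Sum>e\<in>Basis. ((V t - V s) - ((V t - f (c t) \<bullet> e) - (V s - f (c s) \<bullet> e))) *\<^sub>R e)) {s..t}"
      unfolding \<phi>_def
      by (intro has_integral_sum has_integral_scaleR_left has_integral_diff D(2) E(2) st) auto
    also have "(\<Sum>e\<in>Basis. ((V t - V s) - ((V t - f (c t) \<bullet> e) - (V s - f (c s) \<bullet> e))) *\<^sub>R e)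
        = (\<Sum>e\<in>Basis. ((f t - f s) \<bullet> e) *\<^sub>R e)"
      by (intro sum.cong refl) (simp add: cst inner_diff_left)
    also have "\<dots> = f t - f s" by (rule euclidean_representation)
    finally show ?thesis .
  qed
  ultimately show ?thesis using that by blast
qed

section \<open>Differentiation of indefinite integrals\<close>

lemma indefinite_integral_mean_value_AE:
  fixes \<phi> :: "real \<Rightarrow> 'a::euclidean_space"
  assumes "\<And>a b. \<phi> integrable_on {a..b}"
  obtains N where "negligible N"
    "\<And>x e. x \<notin> N \<Longrightarrow> 0 < e \<Longrightarrow> \<exists>d>0. \<forall>h. 0 < h \<and> h < d \<longrightarrow>
       norm (integral {x..x + h} \<phi> - h *\<^sub>R \<phi> x) \<le> e * h \<and> norm (integral {x - h..x} \<phi> - h *\<^sub>R \<phi> x) \<le> e * h"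
proof -
  \<comment> \<open>The differentiation theorem for integrals averages over boxes with lower corner
    \<open>x\<close>, so on the line it sees only the right side of \<open>x\<close>.\<close>
  have right: "\<exists>N. negligible N \<and> (\<forall>x e. x \<notin> N \<longrightarrow> 0 < e \<longrightarrow> (\<exists>d>0. \<forall>h. 0 < h \<and> h < d \<longrightarrow>
       norm (integral {x..x + h} \<psi> - h *\<^sub>R \<psi> x) \<le> e * h))"
    if \<psi>: "\<And>a b. \<psi> integrable_on cbox a b" for \<psi> :: "real \<Rightarrow> 'a"
  proof -
    obtain N where N: "negligible N" "\<And>x e. \<lbrakk>x \<notin> N; 0 < e\<rbrakk> \<Longrightarrow>
               \<exists>d>0. \<forall>h. 0 < h \<and> h < d \<longrightarrow>
                         norm(integral (cbox x (x + h *\<^sub>R One)) \<psi> /\<^sub>R h ^ DIM(real) - \<psi> x) < e"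
      using integrable_ccontinuous_explicit[OF \<psi>] by metis
    have "norm (integral {x..x + h} \<psi> - h *\<^sub>R \<psi> x) \<le> e * h"
      if "norm(integral (cbox x (x + h *\<^sub>R One)) \<psi> /\<^sub>R h ^ DIM(real) - \<psi> x) < e" "0 < h" for x h e
    proof -
      have "integral {x..x + h} \<psi> - h *\<^sub>R \<psi> x = h *\<^sub>R (integral {x..x + h} \<psi> /\<^sub>R h - \<psi> x)"
        using \<open>0 < h\<close> by (simp add: scaleR_diff_right)
      then have "norm (integral {x..x + h} \<psi> - h *\<^sub>R \<psi> x) = h * norm (integral {x..x + h} \<psi> /\<^sub>R h - \<psi> x)"
        using \<open>0 < h\<close> by simp
      also have "\<dots> \<le> h * e" using that by (intro mult_left_mono) (auto simp: less_imp_le)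
      finally show ?thesis by (simp add: mult.commute)
    qed
    with N show ?thesis by (metis (no_types, lifting))
  qed
  obtain N1 where N1: "negligible N1" "\<And>x e. x \<notin> N1 \<Longrightarrow> 0 < e \<Longrightarrow> \<exists>d>0. \<forall>h. 0 < h \<and> h < d \<longrightarrow>
       norm (integral {x..x + h} \<phi> - h *\<^sub>R \<phi> x) \<le> e * h"
    using right[of \<phi>] assms by auto
  \<comment> \<open>Reflection turns left averages of \<open>\<phi>\<close> into right averages of
    \<open>\<psi>\<close>; the exceptional set is reflected along with it.\<close>
  define \<psi> where "\<psi> = (\<lambda>x. \<phi> (- x))"
  have "\<psi> integrable_on cbox a b" for a b
    using Henstock_Kurzweil_Integration.integrable_reflect_real[where f = \<phi> and a = "-b" and b = "-a"] assms[of "-b" "-a"] by (simp add: \<psi>_def)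
  then obtain N2 where N2: "negligible N2" "\<And>x e. x \<notin> N2 \<Longrightarrow> 0 < e \<Longrightarrow> \<exists>d>0. \<forall>h. 0 < h \<and> h < d \<longrightarrow>
       norm (integral {x..x + h} \<psi> - h *\<^sub>R \<psi> x) \<le> e * h"
    using right[of \<psi>] by auto
  have "negligible (uminus ` N2)"
    by (rule negligible_differentiable_image_negligible[OF _ N2(1)]) (auto intro!: derivative_intros)
  show ?thesis
  proof (rule that[of "N1 \<union> uminus ` N2"])
    show "negligible (N1 \<union> uminus ` N2)" using N1(1) \<open>negligible (uminus ` N2)\<close> by (rule negligible_Un)
    fix x e :: real assume x: "x \<notin> N1 \<union> uminus ` N2" "0 < e"
    then have "- x \<notin> N2" by force
    obtain d1 where d1: "d1 > 0" "\<And>h. 0 < h \<Longrightarrow> h < d1 \<Longrightarrow> norm (integral {x..x + h} \<phi> - h *\<^sub>R \<phi> x) \<le> e * h"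
      using N1(2)[of x e] x by auto
    obtain d2 where d2: "d2 > 0" "\<And>h. 0 < h \<Longrightarrow> h < d2 \<Longrightarrow> norm (integral {-x..-x + h} \<psi> - h *\<^sub>R \<psi> (-x)) \<le> e * h"
      using N2(2)[of "-x" e] x \<open>- x \<notin> N2\<close> by auto
    have "integral {-x..-x + h} \<psi> = integral {x - h..x} \<phi>" for h
      using Henstock_Kurzweil_Integration.integral_reflect_real[where f = \<phi> and a = "x - h" and b = x] by (simp add: \<psi>_def)
    then have "norm (integral {x - h..x} \<phi> - h *\<^sub>R \<phi> x) \<le> e * h" if "0 < h" "h < d2" for h
      using d2(2)[OF that] by (simp add: \<psi>_def)
    with d1 d2(1) show "\<exists>d>0. \<forall>h. 0 < h \<and> h < d \<longrightarrow>
       norm (integral {x..x + h} \<phi> - h *\<^sub>R \<phi> x) \<le> e * h \<and> norm (integral {x - h..x} \<phi> - h *\<^sub>R \<phi> x) \<le> e * h"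
      by (intro exI[of _ "min d1 d2"]) auto
  qed
qed

text \<open>Off a null set the density is the two-sided derivative of \<open>f\<close>, so
  \<open>vector_derivative\<close> may replace it under the integral.\<close>

lemma absolutely_continuous_on_vector_derivative:
  fixes f :: "real \<Rightarrow> 'a::euclidean_space"
  assumes ac: "absolutely_continuous_on {a..b} f"
  shows "negligible {x \<in> {a..b}. \<not> f differentiable at x}"
    and "(\<lambda>x. vector_derivative f (at x)) absolutely_integrable_on {a..b}"
    and "\<And>s t. a \<le> s \<Longrightarrow> s \<le> t \<Longrightarrow> t \<le> b \<Longrightarrow>
      ((\<lambda>x. vector_derivative f (at x)) has_integral f t - f s) {s..t}"
proof -
  have "negligible {x \<in> {a..b}. \<not> f differentiable at x} \<and>
    (\<lambda>x. vector_derivative f (at x)) absolutely_integrable_on {a..b} \<and>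
    (\<forall>s t. a \<le> s \<longrightarrow> s \<le> t \<longrightarrow> t \<le> b \<longrightarrow> ((\<lambda>x. vector_derivative f (at x)) has_integral f t - f s) {s..t})"
  proof (cases "a \<le> b")
    case True
    obtain \<phi> where \<phi>: "\<phi> absolutely_integrable_on UNIV"
      "\<And>s t. a \<le> s \<Longrightarrow> s \<le> t \<Longrightarrow> t \<le> b \<Longrightarrow> (\<phi> has_integral f t - f s) {s..t}"
      using absolutely_continuous_on_imp_density[OF ac True] by metis
    have sub: "\<phi> absolutely_integrable_on {u..v}" for u v
      using \<phi>(1) by (rule set_integrable_subset) auto
    obtain N where N: "negligible N"
      "\<And>x e. x \<notin> N \<Longrightarrow> 0 < e \<Longrightarrow> \<exists>d>0. \<forall>h. 0 < h \<and> h < d \<longrightarrow>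
         norm (integral {x..x + h} \<phi> - h *\<^sub>R \<phi> x) \<le> e * h \<and> norm (integral {x - h..x} \<phi> - h *\<^sub>R \<phi> x) \<le> e * h"
      using indefinite_integral_mean_value_AE[of \<phi>] set_lebesgue_integral_eq_integral(1)[OF sub] by metis
    have deriv: "(f has_vector_derivative \<phi> x) (at x)" if x: "a < x" "x < b" "x \<notin> N" for x
      unfolding has_vector_derivative_def has_derivative_at_alt
    proof (intro conjI allI impI)
      show "bounded_linear (\<lambda>h. h *\<^sub>R \<phi> x)" by (rule bounded_linear_scaleR_left)
      fix e :: real assume "0 < e"
      from N(2)[OF x(3) this] obtain d where d: "0 < d" "\<And>h. 0 < h \<Longrightarrow> h < d \<Longrightarrow> norm (integral {x..x + h} \<phi> - h *\<^sub>R \<phi> x) \<le> e * h"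
        "\<And>h. 0 < h \<Longrightarrow> h < d \<Longrightarrow> norm (integral {x - h..x} \<phi> - h *\<^sub>R \<phi> x) \<le> e * h"
        by auto
      have "norm (f y - f x - (y - x) *\<^sub>R \<phi> x) \<le> e * norm (y - x)"
        if y: "norm (y - x) < min d (min (x - a) (b - x))" for y
      proof -
        consider "y = x" | "x < y" | "y < x" by linarith
        then show ?thesis
        proof cases
          case 2
          have "integral {x..x + (y - x)} \<phi> = f y - f x"
            using \<phi>(2)[of x y] x y 2 by (intro integral_unique) auto
          then show ?thesis using d(2)[of "y - x"] y 2 by simp
        next
          case 3
          have "integral {x - (x - y)..x} \<phi> = f x - f y"
            using \<phi>(2)[of y x] x y 3 by (intro integral_unique) auto
          then have "norm (f x - f y - (x - y) *\<^sub>R \<phi> x) \<le> e * (x - y)"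
            using d(3)[of "x - y"] y 3 by simp
          also have "f x - f y - (x - y) *\<^sub>R \<phi> x = - (f y - f x - (y - x) *\<^sub>R \<phi> x)"
            by (simp add: algebra_simps)
          finally show ?thesis using 3 unfolding norm_minus_cancel by simp
        qed simp
      qed
      then show "\<exists>d>0. \<forall>y. norm (y - x) < d \<longrightarrow> norm (f y - f x - (y - x) *\<^sub>R \<phi> x) \<le> e * norm (y - x)"
        using d(1) x by (intro exI[of _ "min d (min (x - a) (b - x))"]) auto
    qed
    \<comment> \<open>The endpoints join the null set, because a two-sided derivative there depends
      on values of \<open>f\<close> outside \<open>[a, b]\<close>.\<close>
    let ?N = "N \<union> {a, b}"
    have negN: "negligible ?N" by (rule negligible_Un[OF N(1) negligible_finite]) simp
    have eq: "vector_derivative f (at x) = \<phi> x" if "x \<in> {a..b} - ?N" for x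
      using that by (intro vector_derivative_at deriv) auto
    have "negligible {x \<in> {a..b}. \<not> f differentiable at x}"
      by (rule negligible_subset[OF negN]) (use deriv in \<open>force intro: differentiableI_vector\<close>)
    moreover have "(\<lambda>x. vector_derivative f (at x)) absolutely_integrable_on {a..b}"
      by (rule absolutely_integrable_spike[OF sub negN eq])
    moreover have "((\<lambda>x. vector_derivative f (at x)) has_integral f t - f s) {s..t}"
      if "a \<le> s" "s \<le> t" "t \<le> b" for s t
      by (rule has_integral_spike[OF negN _ \<phi>(2)[OF that]]) (use eq that in auto)
    ultimately show ?thesis by blast
  qed (auto simp: set_integrable_def)
  then show "negligible {x \<in> {a..b}. \<not> f differentiable at x}"
    "(\<lambda>x. vector_derivative f (at x)) absolutely_integrable_on {a..b}"
    "\<And>s t. a \<le> s \<Longrightarrow> s \<le> t \<Longrightarrow> t \<le> b \<Longrightarrow>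
      ((\<lambda>x. vector_derivative f (at x)) has_integral f t - f s) {s..t}" by blast+
qed

text \<open>As both derivatives exist, one small step to the right determines each of them up to
  \<open>e / 2\<close>; dividing the increment inequality by that step gives the claim up to
  \<open>e\<close>.\<close>

lemma norm_vector_derivative_le:
  fixes f :: "real \<Rightarrow> 'a::euclidean_space" and W :: "real \<Rightarrow> real"
  assumes f: "f differentiable at x" and W: "W differentiable at x" and x: "x < b"
    and le: "\<And>y. x \<le> y \<Longrightarrow> y < b \<Longrightarrow> norm (f y - f x) \<le> W y - W x"
  shows "norm (vector_derivative f (at x)) \<le> vector_derivative W (at x)"
proof (rule field_le_epsilon)
  fix e :: real assume "0 < e"
  let ?f = "vector_derivative f (at x)" and ?W = "vector_derivative W (at x)"
  have "(f has_derivative (\<lambda>h. h *\<^sub>R ?f)) (at x)" "(W has_derivative (\<lambda>h. h *\<^sub>R ?W)) (at x)"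
    using f W by (simp_all add: vector_derivative_works has_vector_derivative_def)
  note derivs = this[unfolded has_derivative_at_alt, THEN conjunct2, THEN spec, THEN mp, OF half_gt_zero[OF \<open>0 < e\<close>]]
  from derivs(1) obtain d1 where d1: "0 < d1" "\<And>y. norm (y - x) < d1 \<Longrightarrow> norm (f y - f x - (y - x) *\<^sub>R ?f) \<le> e / 2 * norm (y - x)"
    by blast
  from derivs(2) obtain d2 where d2: "0 < d2" "\<And>y. norm (y - x) < d2 \<Longrightarrow> norm (W y - W x - (y - x) *\<^sub>R ?W) \<le> e / 2 * norm (y - x)"
    by blast
  define h where "h = min (min d1 d2) (b - x) / 2"
  have h: "0 < h" "h < d1" "h < d2" "x + h < b" using d1(1) d2(1) x by (auto simp: h_def min_def field_simps)
  have "h * norm ?f = norm (h *\<^sub>R ?f)" using h by simp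
  also have "\<dots> \<le> norm (f (x + h) - f x - h *\<^sub>R ?f) + norm (f (x + h) - f x)"
    using norm_triangle_ineq4[of "f (x + h) - f x" "f (x + h) - f x - h *\<^sub>R ?f"] by simp
  also have "\<dots> \<le> e / 2 * h + (W (x + h) - W x)"
    using d1(2)[of "x + h"] le[of "x + h"] h by (intro add_mono) auto
  also have "W (x + h) - W x \<le> e / 2 * h + h * ?W"
    using abs_le_D1[OF d2(2)[of "x + h", unfolded real_norm_def]] h by (simp add: algebra_simps)
  finally have "h * norm ?f \<le> h * (?W + e)" by (simp add: algebra_simps)
  then show "norm ?f \<le> ?W + e" using h by simp
qed

text \<open>Each chord is the norm of an integral of the derivative, so chord sums stay below the
  integral of the speed. The converse integrates the pointwise bound by the derivative of the
  variation function, which is itself absolutely continuous and so recovers its increments.\<close>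

lemma norm_vector_derivative_has_integral_variation:
  fixes f :: "real \<Rightarrow> 'a::euclidean_space"
  assumes ac: "absolutely_continuous_on {a..b} f" and ab: "a \<le> b"
  shows "((\<lambda>x. norm (vector_derivative f (at x))) has_integral variation f a b) {a..b}"
proof -
  let ?v = "\<lambda>x. vector_derivative f (at x)" and ?n = "\<lambda>x. norm (vector_derivative f (at x))"
  have sub: "?v absolutely_integrable_on {s..t}" if "a \<le> s" "t \<le> b" for s t
    using absolutely_continuous_on_vector_derivative(2)[OF ac] by (rule set_integrable_subset) (use that in auto)
  have nint: "?n integrable_on {s..t}" if "a \<le> s" "t \<le> b" for s t
    using sub[OF that] by (simp add: absolutely_integrable_on_def)
  have bv: "bounded_variation f s t" if "a \<le> s" "t \<le> b" for s t
    using ac that by (rule absolutely_continuous_on_variationI)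
  \<comment> \<open>The right end \<open>b\<close> stays fixed while the starting point varies, so
    that the induction can peel links off the front.\<close>
  have "chord_sum f (x # xs) \<le> integral {x..b} ?n" if "sorted (x # xs)" "set (x # xs) \<subseteq> {a..b}" for x xs
    using that
  proof (induction xs arbitrary: x)
    case Nil
    then show ?case using nint[of x b] by (simp add: integral_nonneg)
  next
    case (Cons y ys)
    have "norm (f y - f x) \<le> integral {x..y} ?n"
    proof -
      have "(?v has_integral f y - f x) {x..y}"
        using Cons.prems by (intro absolutely_continuous_on_vector_derivative(3)[OF ac]) auto
      then have "norm (f y - f x) = norm (integral {x..y} ?v)" by (simp add: integral_unique)
      also have "\<dots> \<le> integral {x..y} ?n"
        using Cons.prems by (intro integral_norm_bound_integral set_lebesgue_integral_eq_integral(1)[OF sub] nint) auto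
      finally show ?thesis .
    qed
    moreover have "chord_sum f (y # ys) \<le> integral {y..b} ?n" using Cons by auto
    moreover have "integral {x..y} ?n + integral {y..b} ?n = integral {x..b} ?n"
      using Cons.prems by (intro Henstock_Kurzweil_Integration.integral_combine nint) auto
    ultimately show ?case by simp
  qed
  moreover have "integral {x..b} ?n \<le> integral {a..b} ?n" if "a \<le> x" "x \<le> b" for x
    using that by (intro integral_subset_le nint) auto
  ultimately have "chord_sum f xs \<le> integral {a..b} ?n" if "xs \<in> partitions a b" for xs
    using that nint[of a b] by (cases xs) (fastforce simp: partitions_def integral_nonneg)+
  then have "variation f a b \<le> integral {a..b} ?n" by (rule variation_least)
  moreover have "integral {a..b} ?n \<le> variation f a b"
  proof -
    let ?W = "variation f a"
    let ?N = "{x \<in> {a..b}. \<not> f differentiable at x} \<union> {x \<in> {a..b}. \<not> ?W differentiable at x} \<union> {a, b}"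
    have acW: "absolutely_continuous_on {a..b} ?W" by (rule absolutely_continuous_on_variation[OF ac])
    have negN: "negligible ?N"
      by (intro negligible_Un[OF negligible_Un negligible_finite]
            absolutely_continuous_on_vector_derivative(1)[OF ac] absolutely_continuous_on_vector_derivative(1)[OF acW]) simp
    have le: "?n x \<le> vector_derivative ?W (at x)" if "x \<in> {a..b} - ?N" for x
    proof (rule norm_vector_derivative_le)
      show "norm (f y - f x) \<le> ?W y - ?W x" if y: "x \<le> y" "y < b" for y
      proof -
        have "?W x + variation f x y = ?W y"
          using \<open>x \<in> {a..b} - ?N\<close> y by (intro variation_combine(2) bv) auto
        moreover have "norm (f y - f x) \<le> variation f x y"
          using \<open>x \<in> {a..b} - ?N\<close> y by (intro norm_diff_le_variation bv) auto
        ultimately show ?thesis by simp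
      qed
    qed (use that in auto)
    \<comment> \<open>\<open>has_integral_le\<close> compares at every point, so both integrands are
      set to 0 on the null set.\<close>
    have "((\<lambda>x. if x \<in> ?N then 0 else ?n x) has_integral integral {a..b} ?n) {a..b}"
      by (rule has_integral_spike[OF negN _ integrable_integral[OF nint]]) auto
    moreover have "((\<lambda>x. if x \<in> ?N then 0 else vector_derivative ?W (at x)) has_integral ?W b - ?W a) {a..b}"
      by (rule has_integral_spike[OF negN _ absolutely_continuous_on_vector_derivative(3)[OF acW]]) (use ab in auto)
    ultimately have "integral {a..b} ?n \<le> ?W b - ?W a"
      by (rule has_integral_le) (use le in auto)
    then show ?thesis by (simp add: variation_self)
  qed
  ultimately show ?thesis using nint[of a b] by (simp add: has_integral_iff)
qed

section \<open>Arc length and the canonical representative\<close>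

lemma ac_pathsD: "g \<in> ac_paths \<Longrightarrow> 0 \<le> a \<Longrightarrow> absolutely_continuous_on {a..b} g"
  unfolding ac_paths_def
  \<comment> \<open>For \<open>a > b\<close> the interval is empty, hence contained in
    \<open>{a..a}\<close>.\<close>
  by (cases "a \<le> b") (auto intro: absolutely_continuous_on_subset[of "{a..a}"])

lemma ac_paths_continuous_on:
  assumes "g \<in> ac_paths"
  shows "continuous_on {0..} g"
proof -
  have "continuous (at x within {0..}) g" if "0 \<le> x" for x
  proof -
    have "continuous_on {0..x + 1} g"
      using absolutely_continuous_on_imp_continuous_on ac_pathsD[OF assms] by blast
    then have "continuous (at x within {0..x + 1}) g"
      using that by (simp add: continuous_on_eq_continuous_within)
    moreover have "at x within {0..x + 1} = at x within {0..}"
      by (rule at_within_nhd[of _ "{..<x + 1}"]) auto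
    ultimately show ?thesis by simp
  qed
  then show ?thesis by (simp add: continuous_on_eq_continuous_within)
qed

text \<open>From here on arc length is handled as a supremum of chord sums; its integral form leaves
  the argument until derivatives of representatives are compared.\<close>

lemma arc_length_eq_variation:
  fixes g :: "real \<Rightarrow> real ^ 'n"
  assumes g: "g \<in> ac_paths" and "0 \<le> t"
  shows "arc_length g t = variation g 0 t"
proof -
  have ac: "absolutely_continuous_on {0..t} g" using ac_pathsD[OF g] by simp
  have "(\<lambda>x. norm (vector_derivative g (at x))) absolutely_integrable_on {0..t}"
    by (rule set_integrable_norm[OF absolutely_continuous_on_vector_derivative(2)[OF ac]])
  then show ?thesis
    unfolding arc_length_def
    using norm_vector_derivative_has_integral_variation[OF ac \<open>0 \<le> t\<close>]
    by (simp add: set_lebesgue_integral_eq_integral(2) integral_unique)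
qed

lemma ac_paths_bounded_variation:
  assumes "g \<in> ac_paths" "0 \<le> a"
  shows "bounded_variation g a b"
  using absolutely_continuous_on_imp_bounded_variation[OF ac_pathsD[OF assms]] .

lemma arc_length_diff:
  fixes g :: "real \<Rightarrow> real ^ 'n"
  assumes "g \<in> ac_paths" "0 \<le> s" "s \<le> t"
  shows "arc_length g t - arc_length g s = variation g s t"
  using variation_combine(2)[of g 0 s t] ac_paths_bounded_variation[OF assms(1)] assms
  by (simp add: arc_length_eq_variation)

lemma arc_length_mono:
  fixes g :: "real \<Rightarrow> real ^ 'n"
  assumes "g \<in> ac_paths" "0 \<le> s" "s \<le> t"
  shows "arc_length g s \<le> arc_length g t"
  using arc_length_diff[OF assms] variation_nonneg[OF ac_paths_bounded_variation[OF assms(1,2)], of t] by simp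

lemma norm_diff_le_arc_length:
  fixes g :: "real \<Rightarrow> real ^ 'n"
  assumes "g \<in> ac_paths" "0 \<le> s" "s \<le> t"
  shows "norm (g t - g s) \<le> arc_length g t - arc_length g s"
  using norm_diff_le_variation[OF ac_paths_bounded_variation[OF assms(1,2)] assms(3)]
  by (simp add: arc_length_diff[OF assms])

lemma arc_length_0:
  fixes g :: "real \<Rightarrow> real ^ 'n"
  assumes "g \<in> ac_paths"
  shows "arc_length g 0 = 0"
  by (simp add: arc_length_eq_variation[OF assms] variation_self)

lemma continuous_on_arc_length:
  fixes g :: "real \<Rightarrow> real ^ 'n"
  assumes "g \<in> ac_paths"
  shows "continuous_on {0..b} (arc_length g)"
proof -
  have "continuous_on {0..b} (variation g 0)"
    by (intro absolutely_continuous_on_imp_continuous_on absolutely_continuous_on_variation ac_pathsD assms) simp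
  then show ?thesis
    by (rule continuous_on_eq) (simp add: arc_length_eq_variation[OF assms])
qed

lemma partitions_bounded:
  assumes "sorted xs" "set xs \<subseteq> {0..}"
  obtains b where "0 \<le> b" "\<And>t. b \<le> t \<Longrightarrow> xs \<in> partitions 0 t"
proof
  let ?b = "Max (insert 0 (set xs))"
  show "0 \<le> ?b" by simp
  have "x \<le> ?b" if "x \<in> set xs" for x using that by simp
  then show "xs \<in> partitions 0 t" if "?b \<le> t" for t
    using that assms unfolding partitions_def by fastforce
qed

text \<open>Every finite list in \<open>[0,\<infinity>[\<close> lies in \<open>[0, t]\<close> for
  large \<open>t\<close>. In the form of a supremum over all finite lists, total length is visibly
  stable under increasing changes of parameter.\<close>

lemma arc_length_tendsto:
  fixes g :: "real \<Rightarrow> real ^ 'n"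
  assumes g: "g \<in> ac_paths"
  shows "((\<lambda>t. ereal (arc_length g t)) \<longlongrightarrow> (SUP xs\<in>{xs. sorted xs \<and> set xs \<subseteq> {0..}}. ereal (chord_sum g xs))) at_top"
    (is "(_ \<longlongrightarrow> ?S) _")
proof (rule increasing_tendsto)
  have upper: "ereal (chord_sum g xs) \<le> ?S" if "sorted xs" "set xs \<subseteq> {0..}" for xs
    using that by (intro SUP_upper) auto
  show "\<forall>\<^sub>F t in at_top. ereal (arc_length g t) \<le> ?S"
    using eventually_ge_at_top[of 0]
  proof eventually_elim
    case (elim t)
    show ?case
    proof (rule ccontr)
      assume "\<not> ereal (arc_length g t) \<le> ?S"
      moreover have "0 \<le> ?S" using upper[of "[]"] by (simp add: zero_ereal_def)
      ultimately obtain s where s: "?S = ereal s" "s < variation g 0 t"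
        using elim by (cases ?S) (auto simp: arc_length_eq_variation[OF g])
      then obtain xs where xs: "xs \<in> partitions 0 t" "variation g 0 t - (variation g 0 t - s) < chord_sum g xs"
        using variation_approx[OF ac_paths_bounded_variation[OF g order_refl, of t], of "variation g 0 t - s"]
        by auto
      from xs(1) have "sorted xs" "set xs \<subseteq> {0..}" by (force simp: partitions_def)+
      then have "ereal (chord_sum g xs) \<le> ereal s"
        using upper[of xs] s(1) by simp
      then show False using xs(2) by simp
    qed
  qed
  fix y assume "y < ?S"
  then obtain xs where xs: "sorted xs" "set xs \<subseteq> {0..}" "y < ereal (chord_sum g xs)"
    by (auto simp: less_SUP_iff)
  obtain b where b: "0 \<le> b" "\<And>t. b \<le> t \<Longrightarrow> xs \<in> partitions 0 t"
    using partitions_bounded[OF xs(1,2)] by blast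
  show "\<forall>\<^sub>F t in at_top. y < ereal (arc_length g t)"
    using eventually_ge_at_top[of b]
  proof eventually_elim
    case (elim t)
    then have "chord_sum g xs \<le> arc_length g t"
      using chord_sum_le_variation[OF ac_paths_bounded_variation[OF g order_refl] b(2)[OF elim]] b(1)
      by (simp add: arc_length_eq_variation[OF g])
    then show ?case using xs(3) by (meson ereal_less_eq(3) less_le_trans)
  qed
qed

lemma total_length_eq_SUP:
  fixes g :: "real \<Rightarrow> real ^ 'n"
  assumes "g \<in> ac_paths"
  shows "total_length g = (SUP xs\<in>{xs. sorted xs \<and> set xs \<subseteq> {0..}}. ereal (chord_sum g xs))"
  unfolding total_length_def
  by (rule tendsto_Lim[OF _ arc_length_tendsto[OF assms]]) simp

lemma total_length_nonneg:
  fixes g :: "real \<Rightarrow> real ^ 'n"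
  assumes "g \<in> ac_paths"
  shows "0 \<le> total_length g"
  unfolding total_length_eq_SUP[OF assms] by (rule SUP_upper2[of "[]"]) auto

section \<open>Paths of finite length\<close>

locale finite_path =
  fixes g :: "real \<Rightarrow> real ^ 'n"
  assumes ac: "g \<in> ac_paths" and finite_length: "total_length g < \<infinity>"
begin

definition len :: real where "len = real_of_ereal (total_length g)"

lemma total_length_eq: "total_length g = ereal len"
  using finite_length total_length_nonneg[OF ac] unfolding len_def by (cases "total_length g") auto

lemma len_nonneg: "0 \<le> len"
  using total_length_nonneg[OF ac] by (simp add: total_length_eq)

lemma arc_length_tendsto_len: "(arc_length g \<longlongrightarrow> len) at_top"
  using arc_length_tendsto[OF ac] unfolding total_length_eq_SUP[OF ac, symmetric] total_length_eq by simp

lemma arc_length_le: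
  assumes "0 \<le> t"
  shows "arc_length g t \<le> len"
proof (rule tendsto_lowerbound[OF arc_length_tendsto_len])
  show "\<forall>\<^sub>F s in at_top. arc_length g t \<le> arc_length g s"
    using eventually_ge_at_top[of t] by eventually_elim (rule arc_length_mono[OF ac assms])
qed simp

text \<open>A chord sum beyond \<open>s\<close> is paid for by the length remaining after
  \<open>s\<close>; read the other way, it bounds the arc length at \<open>s\<close> from
  above.\<close>

lemma chord_sum_le:
  assumes "xs \<in> partitions s b" "0 \<le> s"
  shows "chord_sum g xs \<le> len - arc_length g s"
proof -
  \<comment> \<open>If \<open>b < s\<close>, only the empty list is left; the maximum avoids a case
    distinction.\<close>
  have "xs \<in> partitions s (max s b)" using assms partitions_mono[of s s b "max s b"] by auto
  then have "chord_sum g xs \<le> variation g s (max s b)"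
    using chord_sum_le_variation[OF ac_paths_bounded_variation[OF ac]] assms by blast
  also have "\<dots> \<le> len - arc_length g s"
    using arc_length_diff[OF ac assms(2), of "max s b"] arc_length_le[of "max s b"] assms(2)
    by (simp add: le_max_iff_disj)
  finally show ?thesis .
qed

lemma chord_sum_le_arc_length:
  assumes "xs \<in> partitions 0 t" "0 \<le> t"
  shows "chord_sum g xs \<le> arc_length g t"
  using chord_sum_le_variation[OF ac_paths_bounded_variation[OF ac order_refl] assms(1)] assms(2)
  by (simp add: arc_length_eq_variation[OF ac])

lemma chord_sum_approx:
  assumes "0 < \<epsilon>"
  obtains xs where "sorted xs" "set xs \<subseteq> {0..}" "len - \<epsilon> < chord_sum g xs"
proof -
  have "ereal (len - \<epsilon>) < total_length g" using assms by (simp add: total_length_eq)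
  then show ?thesis using that unfolding total_length_eq_SUP[OF ac] by (auto simp: less_SUP_iff)
qed

lemma arc_length_approx:
  assumes "y < len"
  obtains u where "0 \<le> u" "y < arc_length g u"
proof -
  have "\<forall>\<^sub>F t in at_top. y < arc_length g t \<and> 0 \<le> t"
    using order_tendstoD(1)[OF arc_length_tendsto_len assms] eventually_ge_at_top[of 0]
    by (rule eventually_conj)
  from eventually_happens'[OF _ this] show ?thesis using that by auto
qed

text \<open>The strict bound matters: a curve may approach its full length only at infinity, so
  \<open>len\<close> itself need not be attained.\<close>

lemma arc_length_surj:
  assumes "0 \<le> y" "y < len"
  obtains u where "0 \<le> u" "arc_length g u = y"
proof -
  obtain v where v: "0 \<le> v" "y < arc_length g v" using arc_length_approx[OF assms(2)] .
  then have "\<exists>u\<ge>0. u \<le> v \<and> arc_length g u = y"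
    using assms(1) continuous_on_arc_length[OF ac, of v] arc_length_0[OF ac] by (intro IVT') auto
  then show ?thesis using that by blast
qed

text \<open>The remaining length bounds every later displacement and tends to 0. Hence the limit of
  \<open>g\<close> at infinity exists, and it inherits the bound.\<close>

lemma norm_limit_diff_le:
  assumes "0 \<le> s"
  shows "norm (Lim at_top g - g s) \<le> len - arc_length g s"
proof -
  have dist: "norm (g t - g s) \<le> len - arc_length g s" if "0 \<le> s" "s \<le> t" for s t
    using norm_diff_le_arc_length[OF ac that] arc_length_le[of t] that by linarith
  have "Cauchy (\<lambda>n. g (real n))"
  proof (rule metric_CauchyI)
    fix e :: real assume "0 < e"
    then obtain u where u: "0 \<le> u" "len - e / 2 < arc_length g u" using arc_length_approx[of "len - e / 2"] by auto
    obtain M where M: "u \<le> real M" using real_arch_simple by blast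
    have near: "dist (g (real m)) (g u) < e / 2" if "M \<le> m" for m
      using dist[of u "real m"] u M that by (simp add: dist_norm)
    show "\<exists>M. \<forall>m\<ge>M. \<forall>n\<ge>M. dist (g (real m)) (g (real n)) < e"
      by (rule exI[of _ M], intro allI impI, rule dist_triangle_half_l[where y = "g u"]) (rule near, assumption)+
  qed
  from Cauchy_convergent[OF this] obtain l where l: "(\<lambda>n. g (real n)) \<longlonglongrightarrow> l"
    unfolding convergent_def by blast
  have le: "norm (l - g s) \<le> len - arc_length g s" if "0 \<le> s" for s
  proof (rule tendsto_upperbound)
    show "(\<lambda>n. norm (g (real n) - g s)) \<longlonglongrightarrow> norm (l - g s)" by (intro tendsto_intros l)
    obtain M where M: "s \<le> real M" using real_arch_simple by blast
    show "\<forall>\<^sub>F n in sequentially. norm (g (real n) - g s) \<le> len - arc_length g s"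
      by (rule eventually_mono[OF eventually_ge_at_top[of M]]) (use M in \<open>intro dist[OF that], simp\<close>)
  qed simp
  have "((\<lambda>s. g s - l) \<longlongrightarrow> 0) at_top"
  proof (rule Lim_null_comparison)
    show "((\<lambda>s. len - arc_length g s) \<longlongrightarrow> 0) at_top"
      using tendsto_diff[OF tendsto_const arc_length_tendsto_len, of len] by simp
    show "\<forall>\<^sub>F s in at_top. norm (g s - l) \<le> len - arc_length g s"
      using eventually_ge_at_top[of 0] by eventually_elim (simp add: le norm_minus_commute)
  qed
  then have "(g \<longlongrightarrow> l) at_top" by (simp add: LIM_zero_iff)
  then have "Lim at_top g = l" by (intro tendsto_Lim) simp
  then show ?thesis using le assms by simp
qed

lemma canonical_rep_beyond: "len \<le> t \<Longrightarrow> canonical_rep g t = Lim at_top g"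
  by (simp add: canonical_rep_def total_length_eq)

text \<open>\<open>sharp\<close> selects the last parameter with the given arc length; between
  \<open>s\<close> and that parameter no length is added, so \<open>g\<close> keeps its value. If
  the full length is already reached at \<open>s\<close>, the bound on the tail shows that
  \<open>g s\<close> is the limit.\<close>

lemma canonical_rep_arc_length:
  assumes s: "0 \<le> s"
  shows "canonical_rep g (arc_length g s) = g s"
proof (cases "arc_length g s < len")
  case True
  let ?S = "{r. 0 \<le> r \<and> arc_length g r \<le> arc_length g s}"
  obtain v where v: "0 \<le> v" "arc_length g s < arc_length g v" using arc_length_approx[OF True] .
  have le_v: "r \<le> v" if "r \<in> ?S" for r
    using arc_length_mono[OF ac v(1), of r] v(2) that by (cases "r \<le> v") auto
  then have eq: "?S = {r \<in> {0..v}. arc_length g r \<le> arc_length g s}" by auto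
  \<comment> \<open>Closedness puts the supremum itself into the set; this is where continuity of
    arc length enters.\<close>
  have "closed ?S"
    unfolding eq by (intro continuous_on_closed_Collect_le continuous_on_arc_length[OF ac] continuous_on_const) simp
  moreover have "bdd_above ?S" using le_v by (rule bdd_aboveI)
  moreover have "s \<in> ?S" using s by simp
  ultimately have sup: "Sup ?S \<in> ?S" "s \<le> Sup ?S"
    using closed_contains_Sup[of ?S] cSup_upper[of s ?S] by blast+
  from sup(1) have "arc_length g (Sup ?S) \<le> arc_length g s" by blast
  with norm_diff_le_arc_length[OF ac s sup(2)] have "norm (g (Sup ?S) - g s) \<le> 0" by linarith
  then show ?thesis using True by (simp add: canonical_rep_def total_length_eq sharp_def)
next
  case False
  then show ?thesis
    using norm_limit_diff_le[OF s] arc_length_le[OF s] by (simp add: canonical_rep_beyond)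
qed

text \<open>Parameters below \<open>len\<close> are arc lengths, and displacement of
  \<open>g\<close> is at most the arc length added. Beyond \<open>len\<close> the bound on the tail
  takes over.\<close>

lemma canonical_rep_lipschitz:
  assumes "0 \<le> s" "s \<le> t"
  shows "norm (canonical_rep g t - canonical_rep g s) \<le> t - s"
proof (cases "s < len")
  case True
  with assms(1) obtain u where u: "0 \<le> u" "arc_length g u = s" by (rule arc_length_surj)
  show ?thesis
  proof (cases "t < len")
    case True
    have "0 \<le> t" using assms by simp
    from this True obtain v where v: "0 \<le> v" "arc_length g v = t" by (rule arc_length_surj)
    show ?thesis
    proof (cases "u \<le> v")
      case True
      then show ?thesis
        using norm_diff_le_arc_length[OF ac u(1) True] canonical_rep_arc_length u v by auto
    next
      case False
      \<comment> \<open>Parameters in reversed order force \<open>s = t\<close>, as arc length is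
        monotone.\<close>
      then have "t \<le> s" using arc_length_mono[OF ac v(1), of u] u v by simp
      then show ?thesis using assms by simp
    qed
  next
    case False
    then show ?thesis
      using norm_limit_diff_le[OF u(1)] canonical_rep_arc_length[OF u(1)] u
      by (simp add: canonical_rep_beyond)
  qed
next
  case False
  then show ?thesis using assms by (simp add: canonical_rep_beyond)
qed

text \<open>Arc length transports a partition for \<open>g\<close> to one for the representative
  without changing the chord sum, so the representative is at least as long as the curve.\<close>

lemma canonical_rep_chord_sum_approx:
  assumes "0 < \<epsilon>"
  obtains xs where "xs \<in> partitions 0 len" "len - \<epsilon> < chord_sum (canonical_rep g) xs"
proof -
  obtain xs where xs: "sorted xs" "set xs \<subseteq> {0..}" "len - \<epsilon> < chord_sum g xs"
    using chord_sum_approx[OF assms] .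
  obtain b where b: "0 \<le> b" "xs \<in> partitions 0 b" using partitions_bounded[OF xs(1,2)] by blast
  have "map (arc_length g) xs \<in> partitions (arc_length g 0) (arc_length g b)"
    using b(2) by (rule partitions_map) (rule arc_length_mono[OF ac])
  then have "map (arc_length g) xs \<in> partitions 0 len"
    using partitions_mono[of 0 0 "arc_length g b" len] arc_length_le[OF b(1)] by (auto simp: arc_length_0[OF ac])
  moreover have "chord_sum (canonical_rep g) (map (arc_length g) xs) = chord_sum g xs"
    by (rule chord_sum_cong) (use xs(2) canonical_rep_arc_length in auto)
  ultimately show ?thesis using that xs(3) by metis
qed

end

section \<open>Frechet distance\<close>

text \<open>Chord sums see only the order of the parameters, so the comparison retains an increasing
  bijection and a bound at every point. Such comparisons can be inverted and composed, which absorbs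
  changes of representative.\<close>

definition frechet_close :: "real \<Rightarrow> (real \<Rightarrow> 'a::real_normed_vector) \<Rightarrow> (real \<Rightarrow> 'a) \<Rightarrow> bool"
  where "frechet_close \<delta> f g \<longleftrightarrow> (\<exists>\<alpha>. bij_betw \<alpha> {0..} {0..} \<and> strict_mono_on {0..} \<alpha> \<and>
    (\<forall>t\<ge>0. norm (f t - g (\<alpha> t)) \<le> \<delta>))"

lemma strict_mono_on_the_inv_into:
  fixes \<alpha> :: "'a::linorder \<Rightarrow> 'b::linorder"
  assumes bij: "bij_betw \<alpha> A B" and mono: "strict_mono_on A \<alpha>"
  shows "strict_mono_on B (the_inv_into A \<alpha>)"
proof (rule strict_mono_onI)
  fix x y assume xy: "x \<in> B" "y \<in> B" "x < y"
  let ?\<beta> = "the_inv_into A \<alpha>"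
  have inv: "?\<beta> z \<in> A" "\<alpha> (?\<beta> z) = z" if "z \<in> B" for z
    using that bij bij_betw_the_inv_into[OF bij] by (auto simp: bij_betw_def f_the_inv_into_f)
  show "?\<beta> x < ?\<beta> y"
  proof (rule ccontr)
    assume "\<not> ?\<beta> x < ?\<beta> y"
    then have "?\<beta> y \<le> ?\<beta> x" by simp
    then have "\<alpha> (?\<beta> y) \<le> \<alpha> (?\<beta> x)"
      using strict_mono_on_leD[OF mono inv(1)[OF xy(2)] inv(1)[OF xy(1)]] by blast
    then show False using inv xy by simp
  qed
qed

lemma frechet_close_sym:
  assumes "frechet_close \<delta> f g"
  shows "frechet_close \<delta> g f"
proof -
  obtain \<alpha> where \<alpha>: "bij_betw \<alpha> {0..} {0..}" "strict_mono_on {0..} \<alpha>" "\<And>t. t \<ge> 0 \<Longrightarrow> norm (f t - g (\<alpha> t)) \<le> \<delta>"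
    using assms unfolding frechet_close_def by blast
  let ?\<beta> = "the_inv_into {0..} \<alpha>"
  have "norm (g t - f (?\<beta> t)) \<le> \<delta>" if "0 \<le> t" for t
  proof -
    have "?\<beta> t \<in> {0..}" "\<alpha> (?\<beta> t) = t"
      using that \<alpha>(1) bij_betw_the_inv_into[OF \<alpha>(1)] by (auto simp: bij_betw_def f_the_inv_into_f)
    then show ?thesis using \<alpha>(3)[of "?\<beta> t"] by (simp add: norm_minus_commute)
  qed
  then show ?thesis
    unfolding frechet_close_def
    using bij_betw_the_inv_into[OF \<alpha>(1)] strict_mono_on_the_inv_into[OF \<alpha>(1,2)] by blast
qed

lemma frechet_close_trans:
  assumes "frechet_close \<delta>1 f g" "frechet_close \<delta>2 g k"
  shows "frechet_close (\<delta>1 + \<delta>2) f k"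
proof -
  obtain \<alpha> where \<alpha>: "bij_betw \<alpha> {0..} {0..}" "strict_mono_on {0..} \<alpha>" "\<And>t. t \<ge> 0 \<Longrightarrow> norm (f t - g (\<alpha> t)) \<le> \<delta>1"
    using assms(1) unfolding frechet_close_def by blast
  obtain \<beta> where \<beta>: "bij_betw \<beta> {0..} {0..}" "strict_mono_on {0..} \<beta>" "\<And>t. t \<ge> 0 \<Longrightarrow> norm (g t - k (\<beta> t)) \<le> \<delta>2"
    using assms(2) unfolding frechet_close_def by blast
  have pos: "0 \<le> \<alpha> t" if "0 \<le> t" for t using \<alpha>(1) that by (auto simp: bij_betw_def)
  have "norm (f t - k ((\<beta> \<circ> \<alpha>) t)) \<le> \<delta>1 + \<delta>2" if "0 \<le> t" for t
    using norm_triangle_ineq[of "f t - g (\<alpha> t)" "g (\<alpha> t) - k (\<beta> (\<alpha> t))"] \<alpha>(3)[OF that] \<beta>(3)[OF pos[OF that]]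
    by simp
  moreover have "bij_betw (\<beta> \<circ> \<alpha>) {0..} {0..}" using \<alpha>(1) \<beta>(1) by (rule bij_betw_trans)
  moreover have "strict_mono_on {0..} (\<beta> \<circ> \<alpha>)"
  proof (rule strict_mono_onI)
    fix s t :: real assume st: "s \<in> {0..}" "t \<in> {0..}" "s < t"
    have "\<alpha> s < \<alpha> t" using strict_mono_onD[OF \<alpha>(2) st] .
    moreover have "\<alpha> s \<in> {0..}" "\<alpha> t \<in> {0..}" using pos st by auto
    ultimately show "(\<beta> \<circ> \<alpha>) s < (\<beta> \<circ> \<alpha>) t" using strict_mono_onD[OF \<beta>(2)] by simp
  qed
  ultimately show ?thesis unfolding frechet_close_def by blast
qed

lemma frechet_close_mono: "frechet_close \<delta> f g \<Longrightarrow> \<delta> \<le> \<delta>' \<Longrightarrow> frechet_close \<delta>' f g"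
  unfolding frechet_close_def by (meson order_trans)

text \<open>The partition is fixed first and \<delta> is then adapted to its number of points, so no
  length of \<open>g\<close> can be missing in \<open>f\<close>. Applied in both directions, this
  shows that all members of a class have the same length.\<close>

lemma frechet_close_imp_total_length_le:
  fixes f g :: "real \<Rightarrow> real ^ 'n"
  assumes f: "f \<in> ac_paths" and g: "g \<in> ac_paths"
    and close: "\<And>\<delta>. 0 < \<delta> \<Longrightarrow> frechet_close \<delta> f g"
  shows "total_length g \<le> total_length f"
  unfolding total_length_eq_SUP[OF g]
proof (rule SUP_least)
  fix xs :: "real list" assume "xs \<in> {xs. sorted xs \<and> set xs \<subseteq> {0..}}"
  then have xs: "sorted xs" "set xs \<subseteq> {0..}" by auto
  obtain b where b: "0 \<le> b" "\<And>t. b \<le> t \<Longrightarrow> xs \<in> partitions 0 t"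
    using partitions_bounded[OF xs] by blast
  show "ereal (chord_sum g xs) \<le> total_length f"
  proof (rule ereal_le_epsilon2)
    fix e :: real assume "0 < e"
    define \<delta> where "\<delta> = e / (2 * (real (length xs) + 1))"
    have \<delta>: "0 < \<delta>" "2 * \<delta> * length xs \<le> e" using \<open>0 < e\<close> by (auto simp: \<delta>_def field_simps)
    from frechet_close_sym[OF close[OF \<delta>(1)]] obtain \<beta> where \<beta>: "bij_betw \<beta> {0..} {0..}" "strict_mono_on {0..} \<beta>"
      "\<And>t. t \<ge> 0 \<Longrightarrow> norm (g t - f (\<beta> t)) \<le> \<delta>"
      unfolding frechet_close_def by blast
    have "map \<beta> xs \<in> partitions (\<beta> 0) (\<beta> b)"
      using b(2)[OF order_refl] by (rule partitions_map) (rule strict_mono_on_leD[OF \<beta>(2)], auto)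
    moreover have "0 \<le> \<beta> 0" using \<beta>(1) by (auto simp: bij_betw_def)
    ultimately have "sorted (map \<beta> xs)" "set (map \<beta> xs) \<subseteq> {0..}" by (force simp: partitions_def)+
    then have "ereal (chord_sum f (map \<beta> xs)) \<le> total_length f"
      unfolding total_length_eq_SUP[OF f] by (intro SUP_upper) auto
    moreover have "chord_sum g xs \<le> chord_sum f (map \<beta> xs) + 2 * \<delta> * length xs"
      using \<beta>(3) xs(2) \<delta>(1) by (intro chord_sum_close) (auto simp: norm_minus_commute)
    then have "chord_sum g xs \<le> chord_sum f (map \<beta> xs) + e" using \<delta>(2) by simp
    then have "ereal (chord_sum g xs) \<le> ereal (chord_sum f (map \<beta> xs)) + ereal e" by simp
    ultimately show "ereal (chord_sum g xs) \<le> total_length f + ereal e"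
      by (meson add_right_mono order_trans)
  qed
qed

section \<open>From essential suprema to pointwise bounds\<close>

lemma Linf_norm_nonneg: "0 \<le> Linf_norm f"
proof (cases "(\<lambda>t. ereal (norm (f t))) \<in> borel_measurable (lebesgue_on {0..})")
  case True
  have "{0..1::real} \<subseteq> {0..}" by auto
  then have "emeasure lebesgue {0..1::real} \<le> emeasure lebesgue {0::real..}" by (intro emeasure_mono) auto
  \<comment> \<open>Over a space of measure 0 the essential supremum of a constant would be the
    least extended real, so positive measure has to be shown.\<close>
  then have "emeasure (lebesgue_on {0..}) (space (lebesgue_on {0::real..})) \<noteq> 0"
    by (auto simp: emeasure_restrict_space space_restrict_space)
  then have "0 = esssup (lebesgue_on {0::real..}) (\<lambda>t. 0 :: ereal)"
    by (simp add: esssup_const)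
  also have "\<dots> \<le> Linf_norm f"
    unfolding Linf_norm_def by (rule esssup_mono) auto
  finally show ?thesis .
\<comment> \<open>By convention a nonmeasurable function has essential supremum top.\<close>
qed (simp add: Linf_norm_def esssup_non_measurable)

lemma path_dist_nonneg: "0 \<le> path_dist f g"
  unfolding path_dist_def by (rule INF_greatest) (rule Linf_norm_nonneg)

text \<open>By continuity, a value above the essential supremum would persist on a short interval,
  which is not null.\<close>

lemma norm_le_Linf_norm:
  fixes f :: "real \<Rightarrow> real ^ 'n"
  assumes cont: "continuous_on {0..} f" and "0 \<le> t"
  shows "ereal (norm (f t)) \<le> Linf_norm f"
proof (rule ccontr)
  assume "\<not> ereal (norm (f t)) \<le> Linf_norm f"
  then obtain c where c: "Linf_norm f < ereal c" "c < norm (f t)"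
    using ereal_dense2[of "Linf_norm f" "ereal (norm (f t))"] unfolding not_le by auto
  have "AE x in lebesgue_on {0..}. ereal (norm (f x)) \<le> Linf_norm f"
    unfolding Linf_norm_def by (rule esssup_AE)
  then have "AE x in lebesgue. x \<in> {0..} \<longrightarrow> norm (f x) \<le> c"
    using c(1) by (auto simp: AE_restrict_space_iff elim!: eventually_mono)
      (meson ereal_less_eq(3) less_imp_le order_trans)
  then have "{x. \<not> (x \<in> {0..} \<longrightarrow> norm (f x) \<le> c)} \<in> null_sets lebesgue"
    by (simp add: AE_iff_null_sets completion.AE_iff_null_sets flip: AE_iff_null)
  then have neg: "negligible {x. \<not> (x \<in> {0..} \<longrightarrow> norm (f x) \<le> c)}"
    by (simp only: negligible_iff_null_sets)
  obtain d where d: "0 < d" "\<And>s. 0 \<le> s \<Longrightarrow> dist s t < d \<Longrightarrow> dist (f s) (f t) < norm (f t) - c"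
    using cont \<open>0 \<le> t\<close> c(2) unfolding continuous_on_iff by (metis atLeast_iff diff_gt_0_iff_gt)
  \<comment> \<open>The interval lies to the right of \<open>t\<close>, so that it stays in the
    half-line also for \<open>t = 0\<close>.\<close>
  have "{t<..<t + d} \<subseteq> {x. \<not> (x \<in> {0..} \<longrightarrow> norm (f x) \<le> c)}"
  proof
    fix s assume s: "s \<in> {t<..<t + d}"
    then have "dist (f s) (f t) < norm (f t) - c" using d(2)[of s] \<open>0 \<le> t\<close> by (auto simp: dist_real_def)
    then have "c < norm (f s)" using norm_triangle_ineq2[of "f t" "f s"] by (simp add: dist_norm norm_minus_commute)
    then show "s \<in> {x. \<not> (x \<in> {0..} \<longrightarrow> norm (f x) \<le> c)}" using s \<open>0 \<le> t\<close> by auto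
  qed
  then have "negligible {t<..<t + d}" using neg negligible_subset by blast
  then show False using d(1) open_not_negligible[of "{t<..<t + d}"] by auto
qed

text \<open>The infimum need not be attained, hence the strict inequality. Continuity turns the
  almost everywhere bound into one at every point.\<close>

lemma path_dist_imp_frechet_close:
  fixes f g :: "real \<Rightarrow> real ^ 'n"
  assumes f: "f \<in> ac_paths" and g: "g \<in> ac_paths" and less: "path_dist f g < ereal \<delta>"
  shows "frechet_close \<delta> f g"
proof -
  obtain \<alpha> where \<alpha>: "\<alpha> \<in> reparametrizations" "Linf_norm (\<lambda>t. f t - g (\<alpha> t)) < ereal \<delta>"
    using less unfolding path_dist_def by (auto simp: INF_less_iff)
  then have bij: "bij_betw \<alpha> {0..} {0..}" and "strict_mono_on {0..} \<alpha>" "\<alpha> \<in> ac_paths"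
    by (auto simp: reparametrizations_def)
  have "\<alpha> ` {0..} \<subseteq> {0..}" using bij by (auto simp: bij_betw_def)
  then have cont: "continuous_on {0..} (\<lambda>t. f t - g (\<alpha> t))"
    by (intro continuous_on_diff ac_paths_continuous_on f
          continuous_on_compose2[OF ac_paths_continuous_on[OF g] ac_paths_continuous_on[OF \<open>\<alpha> \<in> ac_paths\<close>]])
  have "ereal (norm (f t - g (\<alpha> t))) < ereal \<delta>" if "0 \<le> t" for t
    by (rule le_less_trans[OF norm_le_Linf_norm[OF cont that] \<alpha>(2)])
  then have "norm (f t - g (\<alpha> t)) \<le> \<delta>" if "0 \<le> t" for t using that by (simp add: less_imp_le)
  then show ?thesis
    unfolding frechet_close_def using bij \<open>strict_mono_on {0..} \<alpha>\<close> by blast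
qed

section \<open>Uniform convergence of canonical representatives\<close>

context finite_path
begin

text \<open>A nearly optimal partition for \<open>g\<close> is split at \<open>u\<close>. The images
  of its pieces under \<open>\<alpha>\<close> bound the length of \<open>f\<close> from below,
  before and after \<open>\<alpha> u\<close>; the second bound, subtracted from the total length of
  \<open>f\<close>, gives the upper estimate. One \<eta> is lost to the choice of the partition, one
  to the comparison of chords.\<close>

lemma arc_length_close:
  assumes "finite_path f" and xs: "xs \<in> partitions 0 b" "len - \<eta> \<le> chord_sum g xs"
    and \<alpha>: "bij_betw \<alpha> {0..} {0..}" "strict_mono_on {0..} \<alpha>"
      "\<And>t. 0 \<le> t \<Longrightarrow> norm (g t - f (\<alpha> t)) \<le> \<delta>"
    and \<delta>: "2 * \<delta> * (real (length xs) + 1) \<le> \<eta>" "0 \<le> \<delta>" and u: "0 \<le> u"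
  shows "arc_length g u - 2 * \<eta> \<le> arc_length f (\<alpha> u)"
    and "arc_length f (\<alpha> u) \<le> finite_path.len f - len + arc_length g u + 2 * \<eta>"
proof -
  interpret f: finite_path f by fact
  \<comment> \<open>The partition may end before \<open>u\<close>, so the interval is enlarged to
    contain the cut.\<close>
  let ?b = "max b u"
  have xs': "xs \<in> partitions 0 ?b" using xs(1) partitions_mono[of 0 0 b ?b] by auto
  obtain ys zs where yz: "ys \<in> partitions 0 u" "zs \<in> partitions u ?b"
    "chord_sum g xs \<le> chord_sum g ys + chord_sum g zs"
    "length ys \<le> length xs + 1" "length zs \<le> length xs + 1"
    by (rule chain_split[OF xs' u, of g]) auto
  have mono: "\<alpha> s \<le> \<alpha> t" if "0 \<le> s" "s \<le> t" for s t
    using that by (intro strict_mono_on_leD[OF \<alpha>(2)]) auto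
  have pos: "0 \<le> \<alpha> t" if "0 \<le> t" for t using \<alpha>(1) that by (auto simp: bij_betw_def)
  have near: "chord_sum g ws \<le> chord_sum f (map \<alpha> ws) + \<eta>"
    if "set ws \<subseteq> {0..}" "length ws \<le> length xs + 1" for ws
  proof -
    have "chord_sum g ws \<le> chord_sum f (map \<alpha> ws) + 2 * \<delta> * length ws"
      using \<alpha>(3) that(1) \<delta>(2) by (intro chord_sum_close) (auto simp: norm_minus_commute)
    \<comment> \<open>A piece can have one point more than \<open>xs\<close>, namely the
      cut.\<close>
    also have "2 * \<delta> * length ws \<le> 2 * \<delta> * (real (length xs) + 1)"
      using that(2) \<delta>(2) by (intro mult_left_mono) auto
    finally show ?thesis using \<delta>(1) by simp
  qed
  have "map \<alpha> ys \<in> partitions (\<alpha> 0) (\<alpha> u)" using yz(1) by (rule partitions_map) (rule mono)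
  then have "map \<alpha> ys \<in> partitions 0 (\<alpha> u)" using partitions_mono[of 0 "\<alpha> 0" "\<alpha> u" "\<alpha> u"] pos by auto
  then have "chord_sum f (map \<alpha> ys) \<le> arc_length f (\<alpha> u)" using pos u by (intro f.chord_sum_le_arc_length) auto
  moreover have "chord_sum g ys \<le> chord_sum f (map \<alpha> ys) + \<eta>"
    using yz(1,4) by (intro near) (force simp: partitions_def)+
  moreover have "map \<alpha> zs \<in> partitions (\<alpha> u) (\<alpha> ?b)"
    using yz(2) by (rule partitions_map) (rule mono, use u in auto)
  then have "chord_sum f (map \<alpha> zs) \<le> f.len - arc_length f (\<alpha> u)" using pos u by (intro f.chord_sum_le) auto
  moreover have "chord_sum g zs \<le> chord_sum f (map \<alpha> zs) + \<eta>"
    using yz(2,5) u by (intro near) (force simp: partitions_def)+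
  moreover have "chord_sum g ys \<le> arc_length g u" using yz(1) u by (rule chord_sum_le_arc_length)
  moreover have "chord_sum g zs \<le> len - arc_length g u" using yz(2) u by (rule chord_sum_le)
  ultimately show "arc_length g u - 2 * \<eta> \<le> arc_length f (\<alpha> u)"
    "arc_length f (\<alpha> u) \<le> f.len - len + arc_length g u + 2 * \<eta>"
    using xs(2) yz(3) by linarith+
qed

text \<open>At an arc length of \<open>g\<close> the two representatives are compared through the
  point \<open>f (\<alpha> u)\<close>, whose arc length is close by
  \<open>arc_length_close\<close>.\<close>

lemma canonical_rep_close:
  assumes "0 < \<epsilon>"
  obtains \<delta> where "0 < \<delta>"
    "\<And>f t. finite_path f \<Longrightarrow> frechet_close \<delta> g f \<Longrightarrow> \<bar>finite_path.len f - len\<bar> \<le> \<delta> \<Longrightarrow> 0 \<le> t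
      \<Longrightarrow> norm (canonical_rep f t - canonical_rep g t) \<le> \<epsilon>"
proof -
  \<comment> \<open>The worst case below adds up to \<open>7 * \<eta>\<close>: four at an arc length
    of \<open>g\<close>, three for reaching it from beyond \<open>len\<close>.\<close>
  define \<eta> where "\<eta> = \<epsilon> / 8"
  have \<eta>: "0 < \<eta>" using assms by (simp add: \<eta>_def)
  obtain xs where xs: "sorted xs" "set xs \<subseteq> {0..}" "len - \<eta> < chord_sum g xs" using chord_sum_approx[OF \<eta>] .
  obtain b where b: "0 \<le> b" "\<And>t. b \<le> t \<Longrightarrow> xs \<in> partitions 0 t"
    using partitions_bounded[OF xs(1,2)] by blast
  define \<delta> where "\<delta> = \<eta> / (2 * (real (length xs) + 1))"
  have \<delta>: "0 < \<delta>" "\<delta> \<le> \<eta>" "2 * \<delta> * (real (length xs) + 1) \<le> \<eta>" using \<eta> by (auto simp: \<delta>_def field_simps)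
  show ?thesis
  proof (rule that[OF \<delta>(1)])
    fix f t assume f: "finite_path f" and close: "frechet_close \<delta> g f"
      and lens: "\<bar>finite_path.len f - len\<bar> \<le> \<delta>" and t: "(0::real) \<le> t"
    interpret f: finite_path f by fact
    obtain \<alpha> where \<alpha>: "bij_betw \<alpha> {0..} {0..}" "strict_mono_on {0..} \<alpha>"
      "\<And>t. 0 \<le> t \<Longrightarrow> norm (g t - f (\<alpha> t)) \<le> \<delta>"
      using close unfolding frechet_close_def by blast
    \<comment> \<open>Three \<eta> bound the change of arc length,
      \<open>2 * \<eta> + \<delta>\<close>, passed on by the Lipschitz bound for \<open>f\<close>;
      the fourth covers the distance of \<open>g u\<close> from
      \<open>f (\<alpha> u)\<close>.\<close>
    have at_arc: "norm (canonical_rep f (arc_length g u) - canonical_rep g (arc_length g u)) \<le> 4 * \<eta>"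
      if u: "0 \<le> u" for u
    proof -
      have pos: "0 \<le> \<alpha> u" using \<alpha>(1) u by (auto simp: bij_betw_def)
      have "\<bar>arc_length f (\<alpha> u) - arc_length g u\<bar> \<le> 3 * \<eta>"
        using arc_length_close[OF f b(2)[OF order_refl] less_imp_le[OF xs(3)] \<alpha> \<delta>(3) less_imp_le[OF \<delta>(1)] u] lens \<delta>(2)
        by linarith
      moreover have "norm (canonical_rep f x - canonical_rep f y) \<le> \<bar>x - y\<bar>" if "0 \<le> x" "0 \<le> y" for x y
        using f.canonical_rep_lipschitz[of x y] f.canonical_rep_lipschitz[of y x] that
        by (cases "x \<le> y") (auto simp: norm_minus_commute)
      then have "norm (canonical_rep f (arc_length f (\<alpha> u)) - canonical_rep f (arc_length g u))
          \<le> \<bar>arc_length f (\<alpha> u) - arc_length g u\<bar>"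
        using arc_length_mono[OF ac order_refl u] arc_length_mono[OF f.ac order_refl pos]
        by (simp add: arc_length_0[OF ac] arc_length_0[OF f.ac])
      ultimately have "norm (f (\<alpha> u) - canonical_rep f (arc_length g u)) \<le> 3 * \<eta>"
        by (simp add: f.canonical_rep_arc_length[OF pos])
      then show ?thesis
        using norm_triangle_ineq[of "g u - f (\<alpha> u)" "f (\<alpha> u) - canonical_rep f (arc_length g u)"] \<alpha>(3)[OF u] \<delta>(2)
        by (simp add: canonical_rep_arc_length[OF u] norm_minus_commute)
    qed
    show "norm (canonical_rep f t - canonical_rep g t) \<le> \<epsilon>"
    proof (cases "t < len")
      case True
      with t obtain u where "0 \<le> u" "arc_length g u = t" by (rule arc_length_surj)
      then show ?thesis using at_arc[of u] \<eta> by (simp add: \<eta>_def)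
    next
      case False
      \<comment> \<open>As \<open>len\<close> need not be attained, an arc length within \<eta> of
        it serves as base point.\<close>
      obtain u where u: "0 \<le> u" "len - \<eta> < arc_length g u" using arc_length_approx[of "len - \<eta>"] \<eta> by auto
      let ?s = "arc_length g u"
      have s: "0 \<le> ?s" "?s \<le> len" using arc_length_le[OF u(1)] arc_length_mono[OF ac order_refl u(1)]
        by (simp_all add: arc_length_0[OF ac])
      have "norm (canonical_rep g len - canonical_rep g ?s) \<le> \<eta>"
        using canonical_rep_lipschitz[OF s] u(2) by linarith
      then have "norm (canonical_rep g t - canonical_rep g ?s) \<le> \<eta>"
        using False by (simp add: canonical_rep_beyond)
      moreover have "norm (canonical_rep f len - canonical_rep f ?s) \<le> \<eta>"
        using f.canonical_rep_lipschitz[OF s] u(2) by linarith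
      \<comment> \<open>The representative of \<open>f\<close> is constant from its own length on,
        and that length exceeds \<open>len\<close> by at most \<delta>.\<close>
      moreover have "norm (canonical_rep f t - canonical_rep f len) \<le> \<eta>"
      proof -
        have "canonical_rep f (max len f.len) = canonical_rep f t" if "f.len \<le> t"
          using that by (simp add: f.canonical_rep_beyond)
        moreover have "norm (canonical_rep f (max len f.len) - canonical_rep f len) \<le> \<eta>"
          using f.canonical_rep_lipschitz[OF len_nonneg, of "max len f.len"] lens \<delta>(2) by linarith
        moreover have "norm (canonical_rep f t - canonical_rep f len) \<le> \<eta>" if "t \<le> f.len"
          using f.canonical_rep_lipschitz[OF len_nonneg, of t] lens \<delta>(2) that False by linarith
        ultimately show ?thesis by (cases "f.len \<le> t") auto
      qed
      moreover have "norm (canonical_rep f t - canonical_rep g t) \<le>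
          norm (canonical_rep f t - canonical_rep f len) + norm (canonical_rep f len - canonical_rep f ?s) +
          norm (canonical_rep f ?s - canonical_rep g ?s) + norm (canonical_rep g t - canonical_rep g ?s)"
      proof -
        have *: "norm (a - e) \<le> norm (a - b) + norm (b - c) + norm (c - d) + norm (e - d)" for a b c d e :: "real ^ 'n"
          using norm_triangle_ineq4[of "a - d" "e - d"] norm_triangle_ineq[of "a - b" "b - d"]
            norm_triangle_ineq[of "b - c" "c - d"] by simp
        show ?thesis by (rule *)
      qed
      ultimately have "norm (canonical_rep f t - canonical_rep g t) \<le> 7 * \<eta>"
        using at_arc[OF u(1)] by linarith
      then show ?thesis using assms by (simp add: \<eta>_def)
    qed
  qed
qed

end

section \<open>Convergence of the derivatives\<close>

lemma norm_vector_derivative_lipschitz: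
  fixes f :: "real \<Rightarrow> 'a::euclidean_space"
  assumes "f differentiable at x" "x < b"
    and "\<And>y. x \<le> y \<Longrightarrow> y < b \<Longrightarrow> norm (f y - f x) \<le> C * (y - x)"
  shows "norm (vector_derivative f (at x)) \<le> C"
proof -
  have "((\<lambda>y. C * y) has_vector_derivative C) (at x)"
    by (auto intro!: derivative_eq_intros)
  then show ?thesis
    using norm_vector_derivative_le[OF assms(1) differentiableI_vector assms(2), of "\<lambda>y. C * y" C] assms(3)
    by (simp add: vector_derivative_at right_diff_distrib)
qed

lemma absolutely_integrable_norm_vector_derivative_powr:
  fixes f :: "real \<Rightarrow> 'a::euclidean_space"
  assumes ac: "absolutely_continuous_on {a..b} f" and p: "0 \<le> p"
    and N: "negligible N" "\<And>x. x \<in> {a..b} - N \<Longrightarrow> norm (vector_derivative f (at x)) \<le> C"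
  shows "(\<lambda>x. norm (vector_derivative f (at x)) powr p) absolutely_integrable_on {a..b}"
proof -
  \<comment> \<open>The truncated integrand is bounded everywhere, also where
    \<open>vector_derivative\<close> is arbitrary, and agrees with the original off
    \<open>N\<close>.\<close>
  let ?k = "\<lambda>x. min (norm (vector_derivative f (at x))) \<bar>C\<bar> powr p"
  have "(\<lambda>x. vector_derivative f (at x)) \<in> borel_measurable (lebesgue_on {a..b})"
    using absolutely_continuous_on_vector_derivative(2)[OF ac]
    by (intro integrable_imp_measurable set_lebesgue_integral_eq_integral(1))
  then have "?k \<in> borel_measurable (lebesgue_on {a..b})" by measurable
  then have "?k absolutely_integrable_on {a..b}"
  proof (rule measurable_bounded_by_integrable_imp_absolutely_integrable)
    show "(\<lambda>x. \<bar>C\<bar> powr p) integrable_on {a..b}" by (rule integrable_const_ivl)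
    show "norm (?k x) \<le> \<bar>C\<bar> powr p" if "x \<in> {a..b}" for x
      using p by (auto intro!: powr_mono2)
  qed auto
  then show ?thesis
    by (rule absolutely_integrable_spike[OF _ N(1)]) (use N(2) in \<open>force simp: min_def\<close>)
qed

text \<open>Values up to \<eta> contribute at most \<open>\<eta> powr p\<close>; for larger ones
  \<open>x\<^sup>2 / \<eta>\<^sup>2\<close> is at least 1. For bounded functions this passes from
  square integrals to every exponent, below or above 2.\<close>

lemma powr_le_quadratic:
  fixes x :: real
  assumes "0 \<le> x" "x \<le> C" "0 < \<eta>" "0 \<le> p"
  shows "x powr p \<le> \<eta> powr p + C powr p / \<eta>\<^sup>2 * x\<^sup>2"
proof (cases "x \<le> \<eta>")
  case True
  then have "x powr p \<le> \<eta> powr p" using assms by (intro powr_mono2) auto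
  then show ?thesis by (simp add: add_increasing2)
next
  case False
  have "x powr p \<le> C powr p * 1" using assms by (simp add: powr_mono2)
  also have "\<dots> \<le> C powr p * (x\<^sup>2 / \<eta>\<^sup>2)"
    using False assms by (intro mult_left_mono) (auto simp: field_simps power_mono)
  finally show ?thesis by (simp add: add_increasing)
qed

text \<open>Parallelogram law, then the factorization
  \<open>4 - s\<^sup>2 = (2 - s) * (2 + s)\<close> for \<open>s = norm (a + b) \<le> 2\<close>. The
  result is linear in \<open>s\<close>, so its integral involves only the length of a sum of
  curves.\<close>

lemma norm_diff_squared_le:
  fixes a b :: "'a::real_inner"
  assumes "norm a \<le> 1" "norm b \<le> 1"
  shows "(norm (a - b))\<^sup>2 \<le> 4 * (2 - norm (a + b))"
proof -
  have "(norm (a - b))\<^sup>2 = 2 * (norm a)\<^sup>2 + 2 * (norm b)\<^sup>2 - (norm (a + b))\<^sup>2"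
    by (simp add: power2_norm_eq_inner inner_add_left inner_add_right inner_diff_left inner_diff_right)
  also have "\<dots> \<le> 4 - (norm (a + b))\<^sup>2"
    using power_mono[OF assms(1), of 2] power_mono[OF assms(2), of 2] by simp
  also have "\<dots> = (2 - norm (a + b)) * (2 + norm (a + b))" by (simp add: algebra_simps power2_eq_square)
  also have "\<dots> \<le> (2 - norm (a + b)) * 4"
    using assms norm_triangle_ineq[of a b] by (intro mult_left_mono) auto
  finally show ?thesis by simp
qed

context finite_path
begin

section \<open>Derivatives of canonical representatives\<close>

lemma absolutely_continuous_on_canonical_rep: "absolutely_continuous_on {0..T} (canonical_rep g)"
  by (rule lipschitz_imp_absolutely_continuous_on[where C = 1]) (auto intro: canonical_rep_lipschitz)

lemma absolutely_continuous_on_canonical_rep_add: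
  assumes "finite_path f"
  shows "absolutely_continuous_on {0..T} (\<lambda>t. canonical_rep f t + canonical_rep g t)"
proof (rule lipschitz_imp_absolutely_continuous_on[where C = 2])
  interpret f: finite_path f by fact
  fix x y :: real assume "x \<in> {0..T}" "y \<in> {0..T}" "x \<le> y"
  then have "norm (canonical_rep f y - canonical_rep f x) \<le> y - x" "norm (canonical_rep g y - canonical_rep g x) \<le> y - x"
    using canonical_rep_lipschitz[of x y] f.canonical_rep_lipschitz[of x y] by auto
  then show "norm (canonical_rep f y + canonical_rep g y - (canonical_rep f x + canonical_rep g x)) \<le> 2 * (y - x)"
    using norm_triangle_ineq[of "canonical_rep f y - canonical_rep f x" "canonical_rep g y - canonical_rep g x"]
    by (simp add: algebra_simps)
qed

lemma norm_derivative_canonical_rep_le: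
  assumes "canonical_rep g differentiable at x" "0 \<le> x"
  shows "norm (vector_derivative (canonical_rep g) (at x)) \<le> 1"
  by (rule norm_vector_derivative_lipschitz[where b = "x + 1"])
     (use assms canonical_rep_lipschitz in auto)

lemma derivative_canonical_rep_beyond:
  assumes "len < x"
  shows "(canonical_rep g has_vector_derivative 0) (at x)"
proof (rule has_vector_derivative_transform_within_open)
  show "((\<lambda>_. Lim at_top g) has_vector_derivative 0) (at x)" by simp
  show "open {len<..}" "x \<in> {len<..}" using assms by auto
  show "\<And>y. y \<in> {len<..} \<Longrightarrow> Lim at_top g = canonical_rep g y" by (simp add: canonical_rep_beyond)
qed

lemma canonical_rep_in_sobolev_space:
  assumes p: "1 \<le> p"
  shows "canonical_rep g \<in> sobolev_space p T"
proof -
  let ?h = "canonical_rep g"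
  have ac: "absolutely_continuous_on {0..T} ?h" by (rule absolutely_continuous_on_canonical_rep)
  then have "continuous_on {0..T} (\<lambda>t. norm (?h t) powr p)"
    using p by (intro continuous_on_powr' continuous_on_norm continuous_on_const
        absolutely_continuous_on_imp_continuous_on) auto
  then have "(\<lambda>t. norm (?h t) powr p) absolutely_integrable_on {0..T}"
    by (rule absolutely_integrable_continuous_real)
  moreover have "(\<lambda>t. norm (vector_derivative ?h (at t)) powr p) absolutely_integrable_on {0..T}"
    by (rule absolutely_integrable_norm_vector_derivative_powr[OF ac _
          absolutely_continuous_on_vector_derivative(1)[OF ac], of p 1])
       (use p norm_derivative_canonical_rep_le in auto)
  ultimately show ?thesis using ac by (simp add: sobolev_space_def)
qed

text \<open>Up to \<open>len\<close>, \<open>norm_diff_squared_le\<close> turns the square into the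
  length deficit of \<open>S\<close>. Between \<open>len\<close> and a larger length of
  \<open>f\<close> only the crude bound 4 holds, but that interval is as short as the difference of
  the lengths. Beyond both lengths the derivatives vanish.\<close>

lemma integral_derivative_diff_squared_le:
  assumes f: "finite_path f" and T: "len \<le> T" "finite_path.len f \<le> T"
    and D: "D = (\<lambda>t. canonical_rep f t - canonical_rep g t)"
    and S: "S = (\<lambda>t. canonical_rep f t + canonical_rep g t)"
    and I: "((\<lambda>t. (norm (vector_derivative D (at t)))\<^sup>2) has_integral I) {0..T}"
  shows "I \<le> 4 * (2 * len - variation S 0 len) + 4 * \<bar>finite_path.len f - len\<bar>"
proof -
  interpret f: finite_path f by fact
  let ?h = "canonical_rep g" and ?k = "canonical_rep f" and ?M = "max len f.len"
  let ?v = "\<lambda>t. vector_derivative S (at t)"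
  have acS: "absolutely_continuous_on {0..len} S"
    unfolding S by (rule absolutely_continuous_on_canonical_rep_add[OF f])
  let ?N = "{x \<in> {0..T}. \<not> ?h differentiable at x} \<union> {x \<in> {0..T}. \<not> ?k differentiable at x} \<union> {0, len, ?M}"
  have negN: "negligible ?N"
    by (intro negligible_Un[OF negligible_Un negligible_finite] absolutely_continuous_on_vector_derivative(1)
          absolutely_continuous_on_canonical_rep f.absolutely_continuous_on_canonical_rep) simp
  \<comment> \<open>If \<open>f\<close> is the shorter curve, then \<open>?M = len\<close> and the
    middle case is empty.\<close>
  define F where "F t = (if t \<le> len then 4 * (2 - norm (?v t)) else if t \<le> ?M then 4 else 0)" for t
  have "(norm (vector_derivative D (at t)))\<^sup>2 \<le> F t" if t: "t \<in> {0..T} - ?N" for t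
  proof -
    let ?a = "vector_derivative ?k (at t)" and ?b = "vector_derivative ?h (at t)"
    have diff: "?k differentiable at t" "?h differentiable at t" using t by auto
    then have der: "(?k has_vector_derivative ?a) (at t)" "(?h has_vector_derivative ?b) (at t)"
      by (simp_all add: vector_derivative_works)
    have vD: "vector_derivative D (at t) = ?a - ?b" and vS: "?v t = ?a + ?b"
      unfolding D S by (intro vector_derivative_at has_vector_derivative_diff has_vector_derivative_add der)+
    have le1: "norm ?a \<le> 1" "norm ?b \<le> 1"
      using f.norm_derivative_canonical_rep_le[OF diff(1)] norm_derivative_canonical_rep_le[OF diff(2)] t by auto
    consider "t \<le> len" | "len < t" "t \<le> ?M" | "?M < t" by linarith
    then show ?thesis
    proof cases
      case 1
      then show ?thesis using norm_diff_squared_le[OF le1] by (simp add: F_def vD vS)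
    next
      case 2
      have "norm (?a - ?b) \<le> 2" using le1 norm_triangle_ineq4[of ?a ?b] by linarith
      then have "(norm (?a - ?b))\<^sup>2 \<le> 2\<^sup>2" by (intro power_mono) auto
      then show ?thesis using 2 by (simp add: F_def vD)
    next
      case 3
      then have "?a = 0" "?b = 0"
        using vector_derivative_at[OF f.derivative_canonical_rep_beyond, of t]
          vector_derivative_at[OF derivative_canonical_rep_beyond, of t] by auto
      then show ?thesis using 3 by (simp add: F_def vD)
    qed
  qed
  note le = this
  have int1: "(F has_integral 4 * (2 * len - variation S 0 len)) {0..len}"
  proof (rule has_integral_eq)
    have "((\<lambda>t. 2 - norm (?v t)) has_integral (2 * len - variation S 0 len)) {0..len}"
      using has_integral_diff[OF has_integral_const_real[of "2::real" 0 len]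
          norm_vector_derivative_has_integral_variation[OF acS len_nonneg]] len_nonneg
      by (simp add: mult.commute)
    then show "((\<lambda>t. 4 * (2 - norm (?v t))) has_integral 4 * (2 * len - variation S 0 len)) {0..len}"
      by (rule has_integral_mult_right)
  qed (simp add: F_def)
  \<comment> \<open>At a joint \<open>F\<close> takes the value of the piece on its left, so one
    point has to be exempted.\<close>
  have int2: "(F has_integral 4 * (?M - len)) {len..?M}"
  proof (rule has_integral_spike[of "{len}"])
    show "((\<lambda>t. 4) has_integral 4 * (?M - len)) {len..?M}"
      using has_integral_const_real[of "4::real" len ?M] by (simp add: mult.commute)
  qed (auto simp: F_def)
  have int3: "(F has_integral 0) {?M..T}"
  proof (rule has_integral_spike[of "{?M}"])
    show "((\<lambda>t. 0) has_integral (0::real)) {?M..T}" by simp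
  qed (auto simp: F_def)
  have "(F has_integral 4 * (2 * len - variation S 0 len) + 4 * (?M - len) + 0) {0..T}"
  proof (rule has_integral_combine[OF _ _ _ int3])
    show "(F has_integral 4 * (2 * len - variation S 0 len) + 4 * (?M - len)) {0..?M}"
      by (rule has_integral_combine[OF _ _ int1 int2]) (use len_nonneg in auto)
  qed (use len_nonneg T in auto)
  then have F: "((\<lambda>t. if t \<in> ?N then 0 else F t) has_integral
      4 * (2 * len - variation S 0 len) + 4 * (?M - len) + 0) {0..T}"
    by (rule has_integral_spike[OF negN, rotated]) auto
  have "((\<lambda>t. if t \<in> ?N then 0 else (norm (vector_derivative D (at t)))\<^sup>2) has_integral I) {0..T}"
    by (rule has_integral_spike[OF negN _ I]) auto
  then have "I \<le> 4 * (2 * len - variation S 0 len) + 4 * (?M - len) + 0"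
    by (rule has_integral_le[OF _ F]) (use le in auto)
  then show ?thesis by (simp add: max_def abs_if split: if_splits)
qed

text \<open>The sum is uniformly close to \<open>2 *\<^sub>R canonical_rep g\<close>, whose length
  is at least \<open>2 * len\<close>, and semicontinuity preserves almost all of it.\<close>

lemma variation_sum_approx:
  assumes "0 < \<epsilon>"
  obtains \<delta> where "0 < \<delta>"
    "\<And>f. finite_path f \<Longrightarrow> (\<And>t. 0 \<le> t \<Longrightarrow> norm (canonical_rep f t - canonical_rep g t) \<le> \<delta>) \<Longrightarrow>
      2 * len - \<epsilon> \<le> variation (\<lambda>t. canonical_rep f t + canonical_rep g t) 0 len"
proof -
  let ?h = "canonical_rep g"
  \<comment> \<open>Doubling turns \<open>\<epsilon> / 4\<close> into \<open>\<epsilon> / 2\<close>;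
    the other half pays for the comparison of chords.\<close>
  obtain xs where xs: "xs \<in> partitions 0 len" "len - \<epsilon> / 4 < chord_sum ?h xs"
    using canonical_rep_chord_sum_approx[of "\<epsilon> / 4"] assms by auto
  define \<delta> where "\<delta> = \<epsilon> / (4 * (real (length xs) + 1))"
  have \<delta>: "0 < \<delta>" "2 * \<delta> * length xs \<le> \<epsilon> / 2" using assms by (auto simp: \<delta>_def field_simps)
  show ?thesis
  proof (rule that[OF \<delta>(1)])
    fix f assume f: "finite_path f"
      and close: "\<And>t. 0 \<le> t \<Longrightarrow> norm (canonical_rep f t - ?h t) \<le> \<delta>"
    let ?S = "\<lambda>t. canonical_rep f t + ?h t"
    have "chord_sum (\<lambda>t. 2 *\<^sub>R ?h t) ys = 2 * chord_sum ?h ys" for ys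
    proof (induction "?h" ys rule: chord_sum.induct)
      case (1 x y zs)
      have "norm (2 *\<^sub>R ?h y - 2 *\<^sub>R ?h x) = 2 * norm (?h y - ?h x)"
        unfolding scaleR_diff_right[symmetric] by simp
      with 1 show ?case by simp
    qed auto
    moreover have "chord_sum (\<lambda>t. 2 *\<^sub>R ?h t) xs \<le> chord_sum ?S (map id xs) + 2 * \<delta> * length xs"
    proof (rule chord_sum_close)
      show "norm (?S (id x) - 2 *\<^sub>R ?h x) \<le> \<delta>" if "x \<in> set xs" for x
        using close[of x] xs(1) that by (auto simp: partitions_def scaleR_2 subset_iff)
    qed (use \<delta>(1) in simp)
    moreover have "chord_sum ?S xs \<le> variation ?S 0 len"
    proof (rule chord_sum_le_variation[OF _ xs(1)])
      show "bounded_variation ?S 0 len"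
        by (intro absolutely_continuous_on_imp_bounded_variation absolutely_continuous_on_canonical_rep_add f)
    qed
    ultimately show "2 * len - \<epsilon> \<le> variation ?S 0 len"
      using xs(2) \<delta>(2) by simp
  qed
qed

end

context finite_path
begin

text \<open>The \<open>p\<close>-th power of \<open>e\<close> is shared out: half to the function, a
  quarter each to the small and the large values of the derivative. The resulting \<delta> is
  uniform over \<open>f\<close>.\<close>

lemma sobolev_norm_le:
  assumes p: "1 \<le> p" and T: "len \<le> T" and "0 < e"
  obtains \<delta> where "0 < \<delta>"
    "\<And>f. finite_path f \<Longrightarrow> finite_path.len f \<le> T \<Longrightarrow> frechet_close \<delta> g f \<Longrightarrow> \<bar>finite_path.len f - len\<bar> \<le> \<delta>
      \<Longrightarrow> sobolev_norm p T (\<lambda>t. canonical_rep f t - canonical_rep g t) \<le> e"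
proof -
  have T0: "0 \<le> T" using len_nonneg T by simp
  have p0: "0 < p" using p by simp
  define E where "E = e powr p"
  have E: "0 < E" using \<open>0 < e\<close> by (simp add: E_def)
  \<comment> \<open>The divisors contain \<open>T + 1\<close> because \<open>T\<close> may be
    0.\<close>
  define \<epsilon> where "\<epsilon> = (E / (2 * (T + 1))) powr (1 / p)"
  define \<eta> where "\<eta> = (E / (4 * (T + 1))) powr (1 / p)"
  \<comment> \<open>The constant of \<open>powr_le_quadratic\<close> for the bound 2, as a
    difference of two representatives is 2-Lipschitz.\<close>
  define K where "K = 2 powr p / \<eta>\<^sup>2"
  \<comment> \<open>The square integral will be at most \<open>8 * \<zeta>\<close>: half of this
    from the length deficit of the sum, half from the difference of the lengths.\<close>
  define \<zeta> where "\<zeta> = E / (32 * K)"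
  have \<epsilon>: "0 < \<epsilon>" "\<epsilon> powr p * T \<le> E / 2"
    using E T0 p0 by (auto simp: \<epsilon>_def powr_powr field_simps)
  have \<eta>: "0 < \<eta>" "\<eta> powr p * T \<le> E / 4"
    using E T0 p0 by (auto simp: \<eta>_def powr_powr field_simps)
  have K: "0 < K" using \<eta>(1) by (simp add: K_def)
  have \<zeta>: "0 < \<zeta>" "K * (8 * \<zeta>) = E / 4" using E K by (auto simp: \<zeta>_def)
  obtain \<delta>1 where \<delta>1: "0 < \<delta>1"
    "\<And>f. finite_path f \<Longrightarrow> (\<And>t. 0 \<le> t \<Longrightarrow> norm (canonical_rep f t - canonical_rep g t) \<le> \<delta>1) \<Longrightarrow>
      2 * len - \<zeta> \<le> variation (\<lambda>t. canonical_rep f t + canonical_rep g t) 0 len"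
    using variation_sum_approx[OF \<zeta>(1)] by blast
  have "0 < min \<epsilon> \<delta>1" using \<epsilon>(1) \<delta>1(1) by simp
  then obtain \<delta>2 where \<delta>2: "0 < \<delta>2"
    "\<And>f t. finite_path f \<Longrightarrow> frechet_close \<delta>2 g f \<Longrightarrow> \<bar>finite_path.len f - len\<bar> \<le> \<delta>2 \<Longrightarrow> 0 \<le> t
      \<Longrightarrow> norm (canonical_rep f t - canonical_rep g t) \<le> min \<epsilon> \<delta>1"
    using canonical_rep_close by blast
  define \<delta> where "\<delta> = min \<delta>2 \<zeta>"
  have "0 < \<delta>" using \<delta>2(1) \<zeta>(1) by (simp add: \<delta>_def)
  then show ?thesis
  proof (rule that)
    fix f assume f: "finite_path f" and fT: "finite_path.len f \<le> T" and close: "frechet_close \<delta> g f"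
      and lens: "\<bar>finite_path.len f - len\<bar> \<le> \<delta>"
    interpret f: finite_path f by fact
    let ?D = "\<lambda>t. canonical_rep f t - canonical_rep g t"
    let ?v = "\<lambda>t. vector_derivative ?D (at t)"
    have near: "norm (?D t) \<le> min \<epsilon> \<delta>1" if "0 \<le> t" for t
      using \<delta>2(2)[OF f frechet_close_mono[OF close] _ that] lens by (simp add: \<delta>_def)
    have lip: "norm (?D y - ?D x) \<le> 2 * (y - x)" if "0 \<le> x" "x \<le> y" for x y
      using norm_triangle_ineq4[of "canonical_rep f y - canonical_rep f x" "canonical_rep g y - canonical_rep g x"]
        canonical_rep_lipschitz[OF that] f.canonical_rep_lipschitz[OF that]
      by (simp add: algebra_simps)
    have ac: "absolutely_continuous_on {0..T} ?D"
      by (rule lipschitz_imp_absolutely_continuous_on[where C = 2]) (use lip in auto)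
    let ?N = "{x \<in> {0..T}. \<not> ?D differentiable at x}"
    have negN: "negligible ?N" by (rule absolutely_continuous_on_vector_derivative(1)[OF ac])
    have v2: "norm (?v t) \<le> 2" if "t \<in> {0..T} - ?N" for t
      by (rule norm_vector_derivative_lipschitz[where b = "t + 1"]) (use that lip in auto)
    have vint: "(\<lambda>t. norm (?v t) powr q) absolutely_integrable_on {0..T}" if "0 \<le> q" for q
      by (rule absolutely_integrable_norm_vector_derivative_powr[OF ac that negN v2])
    have "continuous_on {0..T} (\<lambda>t. norm (?D t) powr p)"
      using p by (intro continuous_on_powr' continuous_on_norm continuous_on_const
          absolutely_continuous_on_imp_continuous_on[OF ac]) auto
    then have Dint: "(\<lambda>t. norm (?D t) powr p) absolutely_integrable_on {0..T}"
      by (rule absolutely_integrable_continuous_real)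

    have "integral {0..T} (\<lambda>t. norm (?D t) powr p) \<le> integral {0..T} (\<lambda>t. \<epsilon> powr p)"
    proof (rule integral_le)
      show "norm (?D t) powr p \<le> \<epsilon> powr p" if "t \<in> {0..T}" for t
        using near[of t] that p by (intro powr_mono2) auto
    qed (use set_lebesgue_integral_eq_integral(1)[OF Dint] in auto)
    also have "\<dots> \<le> E / 2" using \<epsilon>(2) T0 by (simp add: mult.commute)
    finally have A: "integral {0..T} (\<lambda>t. norm (?D t) powr p) \<le> E / 2" .

    have "(\<lambda>t. (norm (?v t))\<^sup>2) integrable_on {0..T}"
      using set_lebesgue_integral_eq_integral(1)[OF vint[of 2]] by simp
    then have I: "((\<lambda>t. (norm (?v t))\<^sup>2) has_integral integral {0..T} (\<lambda>t. (norm (?v t))\<^sup>2)) {0..T}"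
      by (rule integrable_integral)
    have "integral {0..T} (\<lambda>t. (norm (?v t))\<^sup>2)
        \<le> 4 * (2 * len - variation (\<lambda>t. canonical_rep f t + canonical_rep g t) 0 len) + 4 * \<bar>f.len - len\<bar>"
      by (rule integral_derivative_diff_squared_le[OF f T fT refl refl I])
    also have "\<dots> \<le> 8 * \<zeta>"
      using \<delta>1(2)[OF f] near lens by (simp add: \<delta>_def)
    finally have I_le: "K * integral {0..T} (\<lambda>t. (norm (?v t))\<^sup>2) \<le> E / 4"
      using mult_left_mono[of "integral {0..T} (\<lambda>t. (norm (?v t))\<^sup>2)" "8 * \<zeta>" K] K \<zeta>(2) by simp

    have "((\<lambda>t. if t \<in> ?N then 0 else norm (?v t) powr p) has_integral
        integral {0..T} (\<lambda>t. norm (?v t) powr p)) {0..T}"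
      by (rule has_integral_spike[OF negN _ integrable_integral[OF set_lebesgue_integral_eq_integral(1)[OF vint]]])
         (use p in auto)
    moreover have "((\<lambda>t. \<eta> powr p + K * (norm (?v t))\<^sup>2) has_integral
        \<eta> powr p * T + K * integral {0..T} (\<lambda>t. (norm (?v t))\<^sup>2)) {0..T}"
      using has_integral_add[OF has_integral_const_real[of "\<eta> powr p" 0 T] has_integral_mult_right[OF I, of K]] T0
      by (simp add: mult.commute)
    ultimately have "integral {0..T} (\<lambda>t. norm (?v t) powr p)
        \<le> \<eta> powr p * T + K * integral {0..T} (\<lambda>t. (norm (?v t))\<^sup>2)"
    proof (rule has_integral_le)
      show "(if t \<in> ?N then 0 else norm (?v t) powr p) \<le> \<eta> powr p + K * (norm (?v t))\<^sup>2" if "t \<in> {0..T}" for t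
        using powr_le_quadratic[of "norm (?v t)" 2 \<eta> p] v2[of t] that \<eta>(1) K p by (simp add: K_def)
    qed
    then have B: "integral {0..T} (\<lambda>t. norm (?v t) powr p) \<le> E / 2" using \<eta>(2) I_le by linarith

    have "sobolev_norm p T ?D =
        (integral {0..T} (\<lambda>t. norm (?D t) powr p) + integral {0..T} (\<lambda>t. norm (?v t) powr p)) powr (1 / p)"
      unfolding sobolev_norm_def
      using set_lebesgue_integral_eq_integral(2)[OF Dint] set_lebesgue_integral_eq_integral(2)[OF vint[of p]] p by simp
    also have "\<dots> \<le> E powr (1 / p)"
      using A B p0 by (intro powr_mono2 add_nonneg_nonneg Henstock_Kurzweil_Integration.integral_nonneg
          set_lebesgue_integral_eq_integral(1)[OF Dint] set_lebesgue_integral_eq_integral(1)[OF vint]) auto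
    also have "\<dots> = e" using \<open>0 < e\<close> p0 by (simp add: E_def powr_powr)
    finally show "sobolev_norm p T ?D \<le> e" .
  qed
qed

end

section \<open>The canonical selector\<close>

text \<open>A class is the image of one path \<open>g0\<close> under the relation. Any two members
  are compared through \<open>g0\<close>, with \<open>\<delta> / 2\<close> on either side, so
  symmetry and transitivity are taken from \<open>frechet_close\<close>.\<close>

lemma finite_frechet_curve_member:
  fixes \<Gamma> :: "(real \<Rightarrow> real ^ 'n) set"
  assumes "\<Gamma> \<in> finite_frechet_curves" "\<gamma> \<in> \<Gamma>"
  shows "finite_path \<gamma>" "curve_length \<Gamma> = ereal (finite_path.len \<gamma>)" "representative \<Gamma> \<in> ac_paths"
    "0 < \<delta> \<Longrightarrow> frechet_close \<delta> \<gamma> (representative \<Gamma>)"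
proof -
  let ?r = "representative \<Gamma>"
  have "\<Gamma> \<in> ac_paths // frechet_rel" "curve_length \<Gamma> < \<infinity>"
    using assms(1) by (auto simp: finite_frechet_curves_def frechet_curves_def)
  then obtain g0 where g0: "\<Gamma> = frechet_rel `` {g0}" by (auto elim: quotientE)
  have member: "k \<in> ac_paths" "g0 \<in> ac_paths" "path_dist g0 k = 0" if "k \<in> \<Gamma>" for k
    using that unfolding g0 frechet_rel_def by auto
  have close0: "frechet_close \<delta> g0 k" if "k \<in> \<Gamma>" "0 < \<delta>" for k \<delta>
    by (rule path_dist_imp_frechet_close) (use member[OF that(1)] that(2) in auto)
  have r: "?r \<in> \<Gamma>" unfolding representative_def by (rule someI[of "\<lambda>k. k \<in> \<Gamma>", OF assms(2)])
  have close: "frechet_close \<delta> k k'" if "k \<in> \<Gamma>" "k' \<in> \<Gamma>" "0 < \<delta>" for k k' \<delta>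
    using frechet_close_trans[OF frechet_close_sym[OF close0[OF that(1), of "\<delta> / 2"]] close0[OF that(2), of "\<delta> / 2"]] that(3)
    by simp
  have eq: "total_length \<gamma> = total_length ?r"
    by (intro antisym frechet_close_imp_total_length_le close r assms(2) member(1))
  show fin: "finite_path \<gamma>"
    using \<open>curve_length \<Gamma> < \<infinity>\<close> member(1)[OF assms(2)] unfolding finite_path_def curve_length_def eq by simp
  show "curve_length \<Gamma> = ereal (finite_path.len \<gamma>)"
    unfolding curve_length_def eq[symmetric] by (rule finite_path.total_length_eq[OF fin])
  show "?r \<in> ac_paths" by (rule member(1)[OF r])
  show "0 < \<delta> \<Longrightarrow> frechet_close \<delta> \<gamma> ?r" by (rule close[OF assms(2) r])
qed

text \<open>The metric is evaluated at the chosen representatives; passing from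
  \<open>\<gamma>1\<close> and \<open>\<gamma>2\<close> to them costs another \<delta> each.\<close>

lemma strong_frechet_dist_imp_close:
  fixes \<Gamma>1 \<Gamma>2 :: "(real \<Rightarrow> real ^ 'n) set"
  assumes 1: "\<Gamma>1 \<in> finite_frechet_curves" "\<gamma>1 \<in> \<Gamma>1" and 2: "\<Gamma>2 \<in> finite_frechet_curves" "\<gamma>2 \<in> \<Gamma>2"
    and "0 < \<delta>" and less: "strong_frechet_dist \<Gamma>1 \<Gamma>2 < ereal \<delta>"
  shows "frechet_close (3 * \<delta>) \<gamma>2 \<gamma>1" "\<bar>finite_path.len \<gamma>1 - finite_path.len \<gamma>2\<bar> \<le> \<delta>"
proof -
  note m1 = finite_frechet_curve_member[OF 1] and m2 = finite_frechet_curve_member[OF 2]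
  have "path_dist (representative \<Gamma>1) (representative \<Gamma>2)
      + ereal \<bar>finite_path.len \<gamma>1 - finite_path.len \<gamma>2\<bar> < ereal \<delta>"
    using less by (simp add: strong_frechet_dist_def frechet_dist_def m1(2) m2(2))
  \<comment> \<open>Both summands are nonnegative, so each is bounded by the sum; the case split
    disposes of infinite distances.\<close>
  then have "path_dist (representative \<Gamma>1) (representative \<Gamma>2) < ereal \<delta>"
    "\<bar>finite_path.len \<gamma>1 - finite_path.len \<gamma>2\<bar> \<le> \<delta>"
    using path_dist_nonneg[of "representative \<Gamma>1" "representative \<Gamma>2"]
    by (cases "path_dist (representative \<Gamma>1) (representative \<Gamma>2)"; simp)+
  then have "frechet_close \<delta> (representative \<Gamma>1) (representative \<Gamma>2)"
    by (intro path_dist_imp_frechet_close m1(3) m2(3))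
  from frechet_close_sym[OF frechet_close_trans[OF frechet_close_trans[OF m1(4)[OF \<open>0 < \<delta>\<close>] this] frechet_close_sym[OF m2(4)[OF \<open>0 < \<delta>\<close>]]]]
  show "frechet_close (3 * \<delta>) \<gamma>2 \<gamma>1" by simp
  show "\<bar>finite_path.len \<gamma>1 - finite_path.len \<gamma>2\<bar> \<le> \<delta>" by fact
qed

theorem theorem9:
  fixes p T :: real
    and \<Gamma> :: "(real \<Rightarrow> real ^ 'n) set" and \<Gamma>s :: "nat \<Rightarrow> (real \<Rightarrow> real ^ 'n) set"
    and \<gamma> :: "real \<Rightarrow> real ^ 'n" and \<gamma>s :: "nat \<Rightarrow> real \<Rightarrow> real ^ 'n"
  assumes "1 \<le> p"
    and "\<Gamma> \<in> finite_frechet_curves" and "\<And>i. \<Gamma>s i \<in> finite_frechet_curves"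
    and "\<gamma> \<in> \<Gamma>" and "\<And>i. \<gamma>s i \<in> \<Gamma>s i"
    and "(\<lambda>i. strong_frechet_dist (\<Gamma>s i) \<Gamma>) \<longlonglongrightarrow> 0"
    and "curve_length \<Gamma> \<le> ereal T" and "\<And>i. curve_length (\<Gamma>s i) \<le> ereal T"
  shows "canonical_rep \<gamma> \<in> sobolev_space p T \<and>
    (\<forall>i. canonical_rep (\<gamma>s i) \<in> sobolev_space p T) \<and>
    (\<lambda>i. sobolev_norm p T (\<lambda>t. canonical_rep (\<gamma>s i) t - canonical_rep \<gamma> t)) \<longlonglongrightarrow> 0"
proof (intro conjI allI)
  note m = finite_frechet_curve_member[OF assms(2,4)] and ms = finite_frechet_curve_member[OF assms(3,5)]
  interpret finite_path \<gamma> by (rule m(1))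
  have T: "len \<le> T" "finite_path.len (\<gamma>s i) \<le> T" for i
    using assms(7) assms(8)[of i] unfolding m(2) ms(2) by simp_all
  show "canonical_rep \<gamma> \<in> sobolev_space p T"
    by (rule canonical_rep_in_sobolev_space[OF assms(1)])
  show "canonical_rep (\<gamma>s i) \<in> sobolev_space p T" for i
    by (rule finite_path.canonical_rep_in_sobolev_space[OF ms(1) assms(1)])
  show "(\<lambda>i. sobolev_norm p T (\<lambda>t. canonical_rep (\<gamma>s i) t - canonical_rep \<gamma> t)) \<longlonglongrightarrow> 0"
  proof (rule tendstoI)
    fix e :: real assume "0 < e"
    \<comment> \<open>The estimate is a weak inequality, whereas \<open>tendstoI\<close> asks for a
      strict one.\<close>
    then have "0 < e / 2" by simp
    then obtain \<delta> where \<delta>: "0 < \<delta>"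
      "\<And>f. finite_path f \<Longrightarrow> finite_path.len f \<le> T \<Longrightarrow> frechet_close \<delta> \<gamma> f \<Longrightarrow> \<bar>finite_path.len f - len\<bar> \<le> \<delta>
        \<Longrightarrow> sobolev_norm p T (\<lambda>t. canonical_rep f t - canonical_rep \<gamma> t) \<le> e / 2"
      using sobolev_norm_le[OF assms(1) T(1)] by blast
    \<comment> \<open>A third, because passing to the given members triples the distance.\<close>
    have \<delta>3: "0 < \<delta> / 3" using \<delta>(1) by simp
    then have "\<forall>\<^sub>F i in sequentially. strong_frechet_dist (\<Gamma>s i) \<Gamma> < ereal (\<delta> / 3)"
      using order_tendstoD(2)[OF assms(6)] by (simp add: zero_ereal_def)
    then show "\<forall>\<^sub>F i in sequentially.
        dist (sobolev_norm p T (\<lambda>t. canonical_rep (\<gamma>s i) t - canonical_rep \<gamma> t)) 0 < e"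
    proof eventually_elim
      case (elim i)
      have "frechet_close \<delta> \<gamma> (\<gamma>s i)" "\<bar>finite_path.len (\<gamma>s i) - len\<bar> \<le> \<delta>"
        using strong_frechet_dist_imp_close[OF assms(3,5,2,4) \<delta>3 elim] \<delta>(1) by simp_all
      then have "sobolev_norm p T (\<lambda>t. canonical_rep (\<gamma>s i) t - canonical_rep \<gamma> t) \<le> e / 2"
        by (rule \<delta>(2)[OF ms(1) T(2)])
      moreover have "0 \<le> sobolev_norm p T (\<lambda>t. canonical_rep (\<gamma>s i) t - canonical_rep \<gamma> t)"
        by (simp add: sobolev_norm_def)
      ultimately show ?case using \<open>0 < e\<close> by simp
    qed
  qed
qed

end
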